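(* Let $\mathcal{H}_A,\mathcal{H}_{A'},\mathcal{H}_B,\mathcal{H}_{B'}$ be finite-dimensional complex Hilbert spaces, let $\rho_{AB}$ and $\rho_{A'B'}$ be density operators on $\mathcal{H}_A\otimes\mathcal{H}_B$ and $\mathcal{H}_{A'}\otimes\mathcal{H}_{B'}$ respectively, and let $\rho_{AA'BB'}=\rho_{AB}\otimes\rho_{A'B'}$ (with tensor factors suitably reordered). Then $$H_{\min}(AA'|BB')_{\rho}=H_{\min}(A|B)_\rho+H_{\min}(A'|B')_\rho$$ and $$H_{\max}(AA'|BB')_{\rho}=H_{\max}(A|B)_\rho+H_{\max}(A'|B')_\rho .$$
   Context: A density operator is a nonnegative (positive semidefinite) operator of trace one; $\mathrm{id}_A$ denotes the identity operator on $\mathcal{H}_A$. For nonnegative operators $\tau,\tau'$ define $D_\infty(\tau\|\tau'):=\inf\{\lambda\in\mathbb{R}:\ \tau\le 2^\lambda\tau'\}$, where $\le$ is the order on Hermitian operators and $\inf\emptyset=+\infty$. For a density operator $\rho_{AB}$ on $\mathcal{H}_A\otimes\mathcal{H}_B$, the conditional min-entropy is $$H_{\min}(A|B)_\rho:=-\inf_{\sigma_B}D_\infty(\rho_{AB}\|\mathrm{id}_A\otimes\sigma_B),$$ where the infimum ranges over all density operators $\sigma_B$ on $\mathcal{H}_B$. The conditional max-entropy is $$H_{\max}(A|B)_\rho:=-H_{\min}(A|C)_\rho ,$$ where the right-hand side is evaluated for the reduced state $\rho_{AC}=\mathrm{tr}_B\,\rho_{ABC}$ of a purification $\rho_{ABC}$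 of $\rho_{AB}$, i.e. a rank-one density operator on $\mathcal{H}_A\otimes\mathcal{H}_B\otimes\mathcal{H}_C$ (for some finite-dimensional $\mathcal{H}_C$) with $\mathrm{tr}_C\,\rho_{ABC}=\rho_{AB}$; the value does not depend on the choice of purification. In $H_{\min}(AA'|BB')$ and $H_{\max}(AA'|BB')$ the first system is $\mathcal{H}_A\otimes\mathcal{H}_{A'}$ and the conditioning system is $\mathcal{H}_B\otimes\mathcal{H}_{B'}$. *)

theory Defs
  imports
    "HOL-Library.Extended_Real"
    "Jordan_Normal_Form.DL_Rank"
    "Jordan_Normal_Form.Schur_Decomposition"
begin

text \<open>
  A finite-dimensional Hilbert space is given by its dimension \<open>d\<close> and identified with
  \<open>carrier_vec d\<close>, operators on it with \<open>carrier_mat d d\<close>.  A tensor product of spaces of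
  dimensions \<open>d\<close> and \<open>e\<close> has dimension \<open>d * e\<close>, and its basis vector
  \<open>|i\<rangle> \<otimes> |j\<rangle>\<close> has index \<open>i * e + j\<close>.  This indexing is associative, so a triple
  product needs no bracketing: \<open>|i\<rangle> \<otimes> |j\<rangle> \<otimes> |k\<rangle>\<close> has index \<open>(i * e + j) * f + k\<close>.
\<close>

definition mat_trace :: "complex mat \<Rightarrow> complex" where
  "mat_trace M = (\<Sum>i<dim_row M. M $$ (i, i))"

definition nonneg_op :: "nat \<Rightarrow> complex mat \<Rightarrow> bool" where
  "nonneg_op n M \<longleftrightarrow>
     M \<in> carrier_mat n n \<and> mat_adjoint M = M \<and>
     (\<forall>v \<in> carrier_vec n. 0 \<le> Re ((M *\<^sub>v v) \<bullet>c v))"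

definition op_le :: "nat \<Rightarrow> complex mat \<Rightarrow> complex mat \<Rightarrow> bool" where
  "op_le n S T \<longleftrightarrow> nonneg_op n (T - S)"

definition density_op :: "nat \<Rightarrow> complex mat \<Rightarrow> bool" where
  "density_op n \<rho> \<longleftrightarrow> nonneg_op n \<rho> \<and> mat_trace \<rho> = 1"

definition tensor_mat :: "complex mat \<Rightarrow> complex mat \<Rightarrow> complex mat" where
  "tensor_mat M N =
     mat (dim_row M * dim_row N) (dim_col M * dim_col N)
       (\<lambda>(i, j). M $$ (i div dim_row N, j div dim_col N) * N $$ (i mod dim_row N, j mod dim_col N))"

text \<open>The partial trace over the last factor of a product of dimensions \<open>d\<close>, \<open>e\<close>, and over
  the middle factor of a product of dimensions \<open>d\<close>, \<open>e\<close>, \<open>f\<close>.\<close>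

definition ptrace_last :: "nat \<Rightarrow> nat \<Rightarrow> complex mat \<Rightarrow> complex mat" where
  "ptrace_last d e M = mat d d (\<lambda>(i, j). \<Sum>k<e. M $$ (i * e + k, j * e + k))"

definition ptrace_mid :: "nat \<Rightarrow> nat \<Rightarrow> nat \<Rightarrow> complex mat \<Rightarrow> complex mat" where
  "ptrace_mid d e f M =
     mat (d * f) (d * f)
       (\<lambda>(i, j). \<Sum>k<e. M $$ ((i div f * e + k) * f + i mod f, (j div f * e + k) * f + j mod f))"

text \<open>Reordering of tensor factors: \<open>reorder_index\<close> maps the index of
  \<open>|a\<rangle> \<otimes> |a'\<rangle> \<otimes> |b\<rangle> \<otimes> |b'\<rangle>\<close> to that of
  \<open>|a\<rangle> \<otimes> |b\<rangle> \<otimes> |a'\<rangle> \<otimes> |b'\<rangle>\<close>, so \<open>reorder_mat\<close> turns an operator on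
  \<open>A \<otimes> B \<otimes> A' \<otimes> B'\<close> into the same operator on \<open>A \<otimes> A' \<otimes> B \<otimes> B'\<close>.\<close>

definition reorder_index :: "nat \<Rightarrow> nat \<Rightarrow> nat \<Rightarrow> nat \<Rightarrow> nat" where
  "reorder_index dA' dB dB' i =
     (let x = i div (dB * dB'); y = i mod (dB * dB');
          a = x div dA'; a' = x mod dA'; b = y div dB'; b' = y mod dB'
      in (a * dB + b) * (dA' * dB') + (a' * dB' + b'))"

definition reorder_mat :: "nat \<Rightarrow> nat \<Rightarrow> nat \<Rightarrow> nat \<Rightarrow> complex mat \<Rightarrow> complex mat" where
  "reorder_mat dA dA' dB dB' M =
     mat ((dA * dA') * (dB * dB')) ((dA * dA') * (dB * dB'))
       (\<lambda>(i, j). M $$ (reorder_index dA' dB dB' i, reorder_index dA' dB dB' j))"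

definition D_infty :: "nat \<Rightarrow> complex mat \<Rightarrow> complex mat \<Rightarrow> ereal" where
  "D_infty n \<tau> \<tau>' = Inf {ereal l | l. op_le n \<tau> (complex_of_real (2 powr l) \<cdot>\<^sub>m \<tau>')}"

text \<open>In both entropies the dimension arguments are those of the first system and of the
  conditioning system.\<close>

definition H_min :: "nat \<Rightarrow> nat \<Rightarrow> complex mat \<Rightarrow> ereal" where
  "H_min dA dB \<rho> = - (INF \<sigma> \<in> Collect (density_op dB). D_infty (dA * dB) \<rho> (tensor_mat (1\<^sub>m dA) \<sigma>))"

definition is_purification :: "nat \<Rightarrow> nat \<Rightarrow> complex mat \<Rightarrow> complex mat \<Rightarrow> bool" where
  "is_purification n dC \<rho> \<psi> \<longleftrightarrow>
     density_op (n * dC) \<psi> \<and> vec_space.rank (n * dC) \<psi> = 1 \<and> ptrace_last n dC \<psi> = \<rho>"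

text \<open>The description is proper because the value does not depend on the purification.\<close>

definition H_max :: "nat \<Rightarrow> nat \<Rightarrow> complex mat \<Rightarrow> ereal" where
  "H_max dA dB \<rho> =
     (THE h. \<exists>dC \<psi>. is_purification (dA * dB) dC \<rho> \<psi> \<and> h = - H_min dA dC (ptrace_mid dA dB dC \<psi>))"

end

theory Submission
  imports Defs "HOL-Analysis.L2_Norm"
begin

text \<open>
  Writing \<open>Y = 2\<^sup>\<lambda> \<sigma>\<close>, the number \<open>2 powr - H_min(A|B)\<close> is the value of the semidefinite
  program minimizing \<open>tr Y\<close> subject to \<open>\<rho> \<le> id \<otimes> Y\<close>; its dual maximizes \<open>tr \<rho> X\<close> over \<open>X \<ge> 0\<close>
  with \<open>tr\<^sub>A X \<le> id\<close>. Tensor products of primal (dual) feasible points are again feasible, and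
  their values multiply, so strong duality makes the value multiplicative. For the max-entropy, any
  two purifications are related by a partial isometry on the purifying system, which preserves the
  value of the program, and the tensor product of purifications purifies the tensor product.
\<close>

subsection \<open>Positive semidefinite kernels\<close>

text \<open>Primal points alone give only one inequality: the product of two of them bounds the
  joint cost from above. The lower bound has to beat every \<open>Y\<close> on
  \<open>B \<times> B'\<close>, including those that do not factor, and a product of dual points
  does this by weak duality. Attainment is never claimed. The cone of pairs of a partial trace and a
  value is not shown to be closed, so separation asks for a positive distance and strong duality
  carries a slack \<epsilon>. A dual point that is only nearly feasible is repaired by dividing it
  by \<open>1 + d\<close>, and the slack disappears after multiplication, through
  \<open>nonpos_of_quadratic_bound\<close>. For the max-entropy the purifying systems may have
  different dimensions, so an isometry need not exist in both directions. A contraction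
  \<open>W\<close> that carries one family of amplitudes to the other shows that the cost does not
  increase; the hypothesis is symmetric, which gives equality.\<close>

text \<open>Operators are treated as kernels \<open>M i j\<close> on a finite index set of arbitrary type, so that a
  tensor product lives on a product set and reordering its factors is a bijection of index sets.\<close>

definition qform :: "'i set \<Rightarrow> ('i \<Rightarrow> 'i \<Rightarrow> complex) \<Rightarrow> ('i \<Rightarrow> complex) \<Rightarrow> complex" where
  "qform I M x = (\<Sum>i\<in>I. \<Sum>j\<in>I. cnj (x i) * M i j * x j)"

text \<open>\<open>x\<close> ranges over all functions, of which \<open>qform\<close> reads only the
  values on \<open>I\<close>. The Hermitian clause is separate because the second clause constrains
  only the real part of the form.\<close>

definition psd :: "'i set \<Rightarrow> ('i \<Rightarrow> 'i \<Rightarrow> complex) \<Rightarrow> bool" where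
  "psd I M \<longleftrightarrow> (\<forall>i\<in>I. \<forall>j\<in>I. M j i = cnj (M i j)) \<and> (\<forall>x. 0 \<le> Re (qform I M x))"

lemma psdI:
  assumes "\<And>i j. i \<in> I \<Longrightarrow> j \<in> I \<Longrightarrow> M j i = cnj (M i j)" and "\<And>x. 0 \<le> Re (qform I M x)"
  shows "psd I M"
  using assms unfolding psd_def by blast

lemma psd_hermitian: "psd I M \<Longrightarrow> i \<in> I \<Longrightarrow> j \<in> I \<Longrightarrow> M j i = cnj (M i j)"
  unfolding psd_def by blast

lemma psd_qform: "psd I M \<Longrightarrow> 0 \<le> Re (qform I M x)"
  unfolding psd_def by blast

lemma qform_cong:
  assumes "\<And>i j. i \<in> I \<Longrightarrow> j \<in> I \<Longrightarrow> M i j = N i j" "\<And>i. i \<in> I \<Longrightarrow> x i = y i"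
  shows "qform I M x = qform I N y"
  unfolding qform_def using assms by (auto intro!: sum.cong)

lemma psd_cong:
  assumes "\<And>i j. i \<in> I \<Longrightarrow> j \<in> I \<Longrightarrow> M i j = N i j"
  shows "psd I M \<longleftrightarrow> psd I N"
  unfolding psd_def using assms qform_cong[of I M N] by auto

lemma qform_add: "qform I (\<lambda>i j. M i j + N i j) x = qform I M x + qform I N x"
  by (simp add: qform_def sum.distrib algebra_simps)

lemma qform_scale: "qform I (\<lambda>i j. c * M i j) x = c * qform I M x"
  by (simp add: qform_def sum_distrib_left algebra_simps)

lemma qform_diff: "qform I (\<lambda>i j. M i j - N i j) x = qform I M x - qform I N x"
  using qform_add[of I M "\<lambda>i j. -1 * N i j" x] qform_scale[of I "-1" N x] by simp

lemma psd_add: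
  assumes "psd I M" "psd I N"
  shows "psd I (\<lambda>i j. M i j + N i j)"
proof (rule psdI)
  show "M j i + N j i = cnj (M i j + N i j)" if "i \<in> I" "j \<in> I" for i j
    by (simp add: psd_hermitian[OF assms(1) that] psd_hermitian[OF assms(2) that])
  show "0 \<le> Re (qform I (\<lambda>i j. M i j + N i j) x)" for x
    using assms[THEN psd_qform, of x] by (simp add: qform_add)
qed

lemma psd_scale:
  assumes "psd I M" "0 \<le> c"
  shows "psd I (\<lambda>i j. complex_of_real c * M i j)"
proof (rule psdI)
  show "complex_of_real c * M j i = cnj (complex_of_real c * M i j)" if "i \<in> I" "j \<in> I" for i j
    by (simp add: psd_hermitian[OF assms(1) that])
  show "0 \<le> Re (qform I (\<lambda>i j. complex_of_real c * M i j) x)" for x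
    using psd_qform[OF assms(1), of x] assms(2) by (simp add: qform_scale)
qed

lemma psd_scale_cancel:
  assumes "psd I (\<lambda>i j. complex_of_real c * M i j)" "0 < c"
  shows "psd I M"
  using psd_scale[OF assms(1), of "1 / c"] assms(2) by simp

section \<open>Principal submatrices and the Gram factorization\<close>

lemma qform_insert:
  assumes "finite I" "a \<notin> I"
  shows "qform (insert a I) M x =
    cnj (x a) * M a a * x a + cnj (x a) * (\<Sum>j\<in>I. M a j * x j)
      + (\<Sum>i\<in>I. cnj (x i) * M i a) * x a + qform I M x"
  using assms
  by (simp add: qform_def sum.distrib sum_distrib_left sum_distrib_right algebra_simps)

text \<open>Extension by zero, the reason why principal submatrices of a positive kernel are
  positive.\<close>

lemma qform_subset:
  assumes "finite J" "I \<subseteq> J"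
  shows "qform J M (\<lambda>i. if i \<in> I then x i else 0) = qform I M x"
proof -
  have fin: "finite I"
    using assms finite_subset by blast
  have "qform J M (\<lambda>i. if i \<in> I then x i else 0)
      = (\<Sum>i\<in>J. if i \<in> I then (\<Sum>j\<in>J. if j \<in> I then cnj (x i) * M i j * x j else 0) else 0)"
    unfolding qform_def by (auto intro!: sum.cong)
  also have "\<dots> = (\<Sum>i\<in>J. if i \<in> I then (\<Sum>j\<in>I. cnj (x i) * M i j * x j) else 0)"
    using assms by (simp add: sum.If_cases Int_absorb1)
  also have "\<dots> = qform I M x"
    unfolding qform_def using assms by (simp add: sum.If_cases Int_absorb1)
  finally show ?thesis .
qed

lemma psd_subset:
  assumes "psd J M" "finite J" "I \<subseteq> J"
  shows "psd I M"
proof (rule psdI)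
  show "M j i = cnj (M i j)" if "i \<in> I" "j \<in> I" for i j
    using psd_hermitian[OF assms(1)] assms(3) that by blast
  show "0 \<le> Re (qform I M x)" for x
    using psd_qform[OF assms(1)] qform_subset[OF assms(2,3)] by metis
qed

lemma psd_diag:
  assumes "psd I M" "finite I" "i \<in> I"
  shows "0 \<le> Re (M i i)" "M i i = complex_of_real (Re (M i i))"
proof -
  have "psd {i} M"
    by (rule psd_subset[OF assms(1,2)]) (use assms(3) in blast)
  from psd_qform[OF this, of "\<lambda>_. 1"] show "0 \<le> Re (M i i)"
    by (simp add: qform_def)
  show "M i i = complex_of_real (Re (M i i))"
    using psd_hermitian[OF assms(1,3,3)] by (metis Reals_cnj_iff of_real_Re)
qed

text \<open>With \<open>M a a = 0\<close> the form on the block \<open>{a, i}\<close> is affine in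
  the coefficient at \<open>a\<close>, so a nonzero off-diagonal entry would make it unbounded
  below.\<close>

lemma psd_zero_diag:
  assumes "psd I M" "finite I" "a \<in> I" "i \<in> I" "M a a = 0"
  shows "M a i = 0"
proof (cases "i = a")
  case False
  have psd: "psd {a, i} M"
    by (rule psd_subset[OF assms(1,2)]) (use assms(3,4) in blast)
  have herm: "M i a = cnj (M a i)"
    using psd_hermitian assms by metis
  have "0 \<le> Re (M i i) - 2 * t * (cmod (M a i))\<^sup>2" for t :: real
  proof -
    define x where "x = (\<lambda>j. if j = a then - complex_of_real t * M a i else 1)"
    have "qform {a, i} M x = M i i - 2 * of_real t * (M a i * cnj (M a i))"
      using False assms(5) herm by (simp add: qform_def x_def algebra_simps)
    also have "M a i * cnj (M a i) = of_real ((cmod (M a i))\<^sup>2)"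
      by (simp only: complex_norm_square)
    finally show ?thesis
      using psd_qform[OF psd, of x] by simp
  qed
  \<comment> \<open>For nonzero \<open>M a i\<close> this \<open>t\<close> makes the expression
    equal to \<open>-1\<close>.\<close>
  from this[of "(Re (M i i) + 1) / (2 * (cmod (M a i))\<^sup>2)"] show ?thesis
    by (cases "M a i = 0") (auto simp: field_simps)
qed (use assms in simp)

text \<open>The columns of \<open>L\<close> are linearly independent, as witnessed by the left inverse \<open>D\<close>; this makes
  \<open>D\<close> applied to any Gram representation of \<open>M\<close> an orthonormal family.\<close>

lemma cholesky:
  assumes "finite I" "psd I M"
  shows "\<exists>K L D. K \<subseteq> I \<and> (\<forall>i\<in>I. \<forall>j\<in>I. M i j = (\<Sum>k\<in>K. L i k * cnj (L j k)))
    \<and> (\<forall>k\<in>K. \<forall>l\<in>K. (\<Sum>i\<in>I. D k i * L i l) = of_bool (k = l))"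
  using assms
proof (induction I arbitrary: M)
  case empty
  show ?case by simp
next
  case (insert a I)
  note psd = insert.prems and fin = \<open>finite I\<close> and a = \<open>a \<notin> I\<close>
  define p where "p = Re (M a a)"
  have p: "p \<ge> 0" "M a a = complex_of_real p"
    using psd_diag[OF psd, of a] fin by (simp_all add: p_def)
  have herm: "M j i = cnj (M i j)" if "i \<in> insert a I" "j \<in> insert a I" for i j
    by (rule psd_hermitian[OF psd that])
  show ?case
  proof (cases "p = 0")
    case True
    \<comment> \<open>A zero pivot forces a zero row and column: the factor gets a zero row and no
      new column.\<close>
    have z: "M a i = 0" "M i a = 0" if "i \<in> insert a I" for i
      using psd_zero_diag[OF psd, of a i] p True fin that herm[of a i] by auto
    have "psd I M"
      by (rule psd_subset[OF psd]) (use fin in auto)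
    from insert.IH[OF this] obtain K L D where
      K: "K \<subseteq> I" and L: "\<And>i j. i \<in> I \<Longrightarrow> j \<in> I \<Longrightarrow> M i j = (\<Sum>k\<in>K. L i k * cnj (L j k))"
      and D: "\<And>k l. k \<in> K \<Longrightarrow> l \<in> K \<Longrightarrow> (\<Sum>i\<in>I. D k i * L i l) = of_bool (k = l)"
      by blast
    define L' where "L' = (\<lambda>i k. if i = a then 0 else L i k)"
    have "M i j = (\<Sum>k\<in>K. L' i k * cnj (L' j k))" if "i \<in> insert a I" "j \<in> insert a I" for i j
      using L z that a by (cases "i = a"; cases "j = a") (auto simp: L'_def)
    moreover have "(\<Sum>i\<in>insert a I. D k i * L' i l) = of_bool (k = l)" if "k \<in> K" "l \<in> K" for k l
    proof -
      have "(\<Sum>i\<in>insert a I. D k i * L' i l) = (\<Sum>i\<in>I. D k i * L i l)"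
        using fin a by (auto simp: L'_def intro!: sum.cong)
      then show ?thesis
        using D that by simp
    qed
    ultimately show ?thesis
      using K by (intro exI[of _ K] exI[of _ L'] exI[of _ D]) auto
  next
    case False
    then have p0: "p > 0"
      using p by simp
    \<comment> \<open>Schur complement of the pivot \<open>p\<close>\<close>
    define N where "N = (\<lambda>i j. M i j - M i a * M a j / of_real p)"
    have "psd I N"
    proof (rule psdI)
      show "N j i = cnj (N i j)" if "i \<in> I" "j \<in> I" for i j
        using herm[of i j] herm[of a i] herm[of a j] that by (simp add: N_def)
      show "0 \<le> Re (qform I N x)" for x
      proof -
        define y where "y = (\<Sum>j\<in>I. M a j * x j)"
        have y': "(\<Sum>i\<in>I. cnj (x i) * M i a) = cnj y"
          unfolding y_def cnj_sum using herm[of a] by (intro sum.cong) auto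
        have "(\<Sum>i\<in>I. \<Sum>j\<in>I. cnj (x i) * (M i a * M a j / of_real p) * x j)
            = (\<Sum>i\<in>I. cnj (x i) * M i a) * y / of_real p"
          unfolding y_def sum_product sum_divide_distrib
          by (intro sum.cong refl) simp
        then have 1: "qform I N x = qform I M x - cnj y * y / of_real p"
          unfolding y' N_def qform_diff by (simp add: qform_def)
        \<comment> \<open>The coordinate at \<open>a\<close> that minimizes the form of
          \<open>M\<close> with the others fixed; the minimum is the form of the Schur
          complement.\<close>
        define x' where "x' = x(a := - y / of_real p)"
        have x': "(\<Sum>j\<in>I. M a j * x' j) = y" "(\<Sum>i\<in>I. cnj (x' i) * M i a) = cnj y"
          "qform I M x' = qform I M x"
          using a unfolding y_def y'[unfolded y_def, symmetric]
          by (auto simp: x'_def intro!: sum.cong qform_cong)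
        have "qform (insert a I) M x' = qform I M x - cnj y * y / of_real p"
          unfolding qform_insert[OF fin a] x' p(2) using p0 by (simp add: x'_def field_simps)
        then show ?thesis
          using psd_qform[OF psd, of x'] 1 by simp
      qed
    qed
    from insert.IH[OF this] obtain K L D where
      K: "K \<subseteq> I" and L: "\<And>i j. i \<in> I \<Longrightarrow> j \<in> I \<Longrightarrow> N i j = (\<Sum>k\<in>K. L i k * cnj (L j k))"
      and D: "\<And>k l. k \<in> K \<Longrightarrow> l \<in> K \<Longrightarrow> (\<Sum>i\<in>I. D k i * L i l) = of_bool (k = l)"
      by blast
    have aK: "a \<notin> K" and finK: "finite K"
      using K a fin finite_subset by blast+
    define r where "r = complex_of_real (sqrt p)"
    have r: "r \<noteq> 0" "r * r = of_real p" "cnj r = r"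
      using p0 unfolding r_def by (simp_all flip: of_real_mult)
    define L' where "L' = (\<lambda>i k. if k = a then M i a / r else if i = a then 0 else L i k)"
    \<comment> \<open>Back substitution for the block triangular \<open>L'\<close>: for
      \<open>k\<close> in \<open>K\<close> the entry at \<open>a\<close> is chosen so that row
      \<open>k\<close> cancels the new column of \<open>L'\<close>.\<close>
    define D' where "D' = (\<lambda>k i. if k = a then (if i = a then 1 / r else 0)
      else if i = a then - (\<Sum>j\<in>I. D k j * M j a) / of_real p else D k i)"
    have sumK: "(\<Sum>k\<in>K. L' i k * cnj (L' j k))
        = (if i = a \<or> j = a then 0 else \<Sum>k\<in>K. L i k * cnj (L j k))" for i j
      using aK by (auto simp: L'_def intro!: sum.cong sum.neutral)
    have "M i j = (\<Sum>k\<in>insert a K. L' i k * cnj (L' j k))"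
      if ij: "i \<in> insert a I" "j \<in> insert a I" for i j
    proof -
      have 1: "L' i a * cnj (L' j a) = M i a * M a j / of_real p"
        using herm[OF ij(2), of a] r by (simp add: L'_def mult.commute flip: r(2))
      have "(\<Sum>k\<in>insert a K. L' i k * cnj (L' j k))
          = M i a * M a j / of_real p + (\<Sum>k\<in>K. L' i k * cnj (L' j k))"
        using finK aK by (simp add: 1)
      also have "\<dots> = M i j"
        using L[of i j] ij p0 p a unfolding sumK by (auto simp: N_def diff_eq_eq add.commute)
      finally show ?thesis ..
    qed
    moreover have "(\<Sum>i\<in>insert a I. D' k i * L' i l) = of_bool (k = l)"
      if kl: "k \<in> insert a K" "l \<in> insert a K" for k l
    proof -
      have s: "(\<Sum>i\<in>insert a I. D' k i * L' i l) = D' k a * L' a l + (\<Sum>i\<in>I. D' k i * L' i l)"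
        using fin a by simp
      consider "k = a" | "k \<in> K" "k \<noteq> a" "l = a" | "k \<in> K" "k \<noteq> a" "l \<in> K" "l \<noteq> a"
        using kl by blast
      then show ?thesis
      proof cases
        case 1
        have "(\<Sum>i\<in>I. D' k i * L' i l) = 0"
          using 1 a by (auto simp: D'_def intro!: sum.neutral)
        then show ?thesis
          using 1 r(1) aK kl unfolding s by (auto simp: D'_def L'_def p(2) r(2)[symmetric])
      next
        case 2
        have "(\<Sum>i\<in>I. D' k i * L' i l) = (\<Sum>j\<in>I. D k j * M j a) / r"
          unfolding sum_divide_distrib using 2 a by (auto simp: D'_def L'_def intro!: sum.cong)
        then show ?thesis
          using 2 r(1) unfolding s by (simp add: D'_def L'_def p(2) r(2)[symmetric])
      next
        case 3
        have "(\<Sum>i\<in>I. D' k i * L' i l) = (\<Sum>i\<in>I. D k i * L i l)"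
          using 3 a by (auto simp: D'_def L'_def intro!: sum.cong)
        then show ?thesis
          using 3 D s by (simp add: L'_def)
      qed
    qed
    ultimately show ?thesis
      using K by (intro exI[of _ "insert a K"] exI[of _ L'] exI[of _ D']) auto
  qed
qed

lemma gram_exists:
  assumes "finite I" "psd I M"
  shows "\<exists>K L. K \<subseteq> I \<and> (\<forall>i\<in>I. \<forall>j\<in>I. M i j = (\<Sum>k\<in>K. L i k * cnj (L j k)))"
  using cholesky[OF assms] by blast

section \<open>Gram sums, the trace pairing and products of positive kernels\<close>

lemma sum_rotate:
  "(\<Sum>i\<in>I. \<Sum>j\<in>J. \<Sum>k\<in>K. f i j k) = (\<Sum>k\<in>K. \<Sum>i\<in>I. \<Sum>j\<in>J. f i j k)"
proof -
  have "(\<Sum>i\<in>I. \<Sum>j\<in>J. \<Sum>k\<in>K. f i j k) = (\<Sum>i\<in>I. \<Sum>k\<in>K. \<Sum>j\<in>J. f i j k)"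
    by (intro sum.cong refl sum.swap)
  also have "\<dots> = (\<Sum>k\<in>K. \<Sum>i\<in>I. \<Sum>j\<in>J. f i j k)"
    by (rule sum.swap)
  finally show ?thesis .
qed

lemma qform_gram:
  "qform I (\<lambda>i j. \<Sum>k\<in>K. L i k * cnj (L j k)) x = (\<Sum>k\<in>K. of_real ((cmod (\<Sum>i\<in>I. cnj (x i) * L i k))\<^sup>2))"
proof -
  have "qform I (\<lambda>i j. \<Sum>k\<in>K. L i k * cnj (L j k)) x
      = (\<Sum>i\<in>I. \<Sum>j\<in>I. \<Sum>k\<in>K. (cnj (x i) * L i k) * (x j * cnj (L j k)))"
    unfolding qform_def sum_distrib_left sum_distrib_right
    by (intro sum.cong refl) simp
  also have "\<dots> = (\<Sum>k\<in>K. \<Sum>i\<in>I. \<Sum>j\<in>I. (cnj (x i) * L i k) * (x j * cnj (L j k)))"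
    by (rule sum_rotate)
  also have "\<dots> = (\<Sum>k\<in>K. of_real ((cmod (\<Sum>i\<in>I. cnj (x i) * L i k))\<^sup>2))"
    unfolding complex_norm_square by (simp add: sum_product)
  finally show ?thesis .
qed

lemma psd_gram: "psd I (\<lambda>i j. \<Sum>k\<in>K. L i k * cnj (L j k))"
proof (rule psdI)
  show "0 \<le> Re (qform I (\<lambda>i j. \<Sum>k\<in>K. L i k * cnj (L j k)) x)" for x
    unfolding qform_gram by (simp flip: of_real_sum add: sum_nonneg)
qed (simp add: mult.commute)

text \<open>The trace of the operator product \<open>M X\<close>, without conjugation.\<close>

definition pairing :: "'i set \<Rightarrow> ('i \<Rightarrow> 'i \<Rightarrow> complex) \<Rightarrow> ('i \<Rightarrow> 'i \<Rightarrow> complex) \<Rightarrow> complex" where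
  "pairing I M X = (\<Sum>i\<in>I. \<Sum>j\<in>I. M i j * X j i)"

text \<open>A Gram factorization splits \<open>M\<close> into rank-one terms, and each of them
  paired with \<open>X\<close> is a value of the quadratic form of \<open>X\<close>.\<close>

lemma pairing_psd_nonneg:
  assumes "finite I" "psd I M" "psd I X"
  shows "0 \<le> Re (pairing I M X)"
proof -
  obtain K L where "K \<subseteq> I" and
    L: "\<forall>i\<in>I. \<forall>j\<in>I. M i j = (\<Sum>k\<in>K. L i k * cnj (L j k))"
    using gram_exists[OF assms(1,2)] by blast
  have "pairing I M X = (\<Sum>i\<in>I. \<Sum>j\<in>I. \<Sum>k\<in>K. cnj (L j k) * X j i * L i k)"
    unfolding pairing_def using L
    by (intro sum.cong refl) (simp add: sum_distrib_left sum_distrib_right mult_ac)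
  also have "\<dots> = (\<Sum>k\<in>K. \<Sum>i\<in>I. \<Sum>j\<in>I. cnj (L j k) * X j i * L i k)"
    by (rule sum_rotate)
  also have "\<dots> = (\<Sum>k\<in>K. qform I X (\<lambda>i. L i k))"
    unfolding qform_def by (rule sum.cong[OF refl], rule sum.swap)
  finally show ?thesis
    using psd_qform[OF assms(3)] by (simp add: sum_nonneg)
qed

text \<open>Products of Gram vectors of the factors are Gram vectors of the tensor product.\<close>

lemma psd_tensor:
  assumes "finite I" "finite J" "psd I M" "psd J N"
  shows "psd (I \<times> J) (\<lambda>(i, j) (k, l). M i k * N j l)"
proof -
  obtain K L where "K \<subseteq> I" and
    L: "\<forall>i\<in>I. \<forall>j\<in>I. M i j = (\<Sum>k\<in>K. L i k * cnj (L j k))"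
    using gram_exists[OF assms(1,3)] by blast
  obtain K' L' where "K' \<subseteq> J" and
    L': "\<forall>i\<in>J. \<forall>j\<in>J. N i j = (\<Sum>k\<in>K'. L' i k * cnj (L' j k))"
    using gram_exists[OF assms(2,4)] by blast
  have "psd (I \<times> J) (\<lambda>p q. \<Sum>(k, k')\<in>K \<times> K'.
      (L (fst p) k * L' (snd p) k') * cnj (L (fst q) k * L' (snd q) k'))"
    unfolding case_prod_unfold by (rule psd_gram)
  also have "?this \<longleftrightarrow> ?thesis"
    using L L' by (intro psd_cong) (auto simp: sum_product sum.cartesian_product mult_ac)
  finally show ?thesis .
qed

lemma psd_reindex:
  assumes "bij_betw f I J"
  shows "psd I (\<lambda>i j. M (f i) (f j)) \<longleftrightarrow> psd J M"
proof -
  define g where "g = inv_into I f"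
  have g: "g j \<in> I" "f (g j) = j" if "j \<in> J" for j
    using assms that unfolding g_def
    by (auto simp: bij_betw_def inv_into_into f_inv_into_f)
  have gf: "g (f i) = i" if "i \<in> I" for i
    using assms that by (simp add: g_def bij_betw_def)
  have fI: "f i \<in> J" if "i \<in> I" for i
    using assms that bij_betwE by metis
  have q: "qform I (\<lambda>i j. M (f i) (f j)) (\<lambda>i. x (f i)) = qform J M x" for x
    unfolding qform_def
    by (subst sum.reindex_bij_betw[OF assms, symmetric], intro sum.cong refl,
        rule sum.reindex_bij_betw[OF assms, of "\<lambda>j. cnj (x (f _)) * M (f _) j * x j"])
  have q': "qform I (\<lambda>i j. M (f i) (f j)) x = qform J M (\<lambda>j. x (g j))" for x
    unfolding q[symmetric] using gf by (intro qform_cong) auto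
  show ?thesis
  proof
    assume *: "psd I (\<lambda>i j. M (f i) (f j))"
    show "psd J M"
    proof (rule psdI)
      show "M j i = cnj (M i j)" if "i \<in> J" "j \<in> J" for i j
        using psd_hermitian[OF *, of "g i" "g j"] g that by simp
      show "0 \<le> Re (qform J M x)" for x
        using psd_qform[OF *, of "\<lambda>i. x (f i)"] q by simp
    qed
  next
    assume *: "psd J M"
    show "psd I (\<lambda>i j. M (f i) (f j))"
    proof (rule psdI)
      show "M (f j) (f i) = cnj (M (f i) (f j))" if "i \<in> I" "j \<in> I" for i j
        using psd_hermitian[OF *] fI that by blast
      show "0 \<le> Re (qform I (\<lambda>i j. M (f i) (f j)) x)" for x
        using psd_qform[OF *] q' by simp
    qed
  qed
qed

section \<open>Domination by multiples of the identity\<close>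

text \<open>Cauchy-Schwarz over pairs of indices. The Hilbert-Schmidt norm stands in for the
  operator norm, which avoids eigenvalues.\<close>

lemma qform_bound:
  assumes "finite I"
  shows "Re (qform I E x) \<le> sqrt (\<Sum>i\<in>I. \<Sum>j\<in>I. (cmod (E i j))\<^sup>2) * (\<Sum>i\<in>I. (cmod (x i))\<^sup>2)"
proof -
  let ?S = "\<lambda>f. \<Sum>(i, j)\<in>I \<times> I. (f i j :: real)"
  have "Re (qform I E x) \<le> cmod (qform I E x)"
    by (rule complex_Re_le_cmod)
  also have "\<dots> \<le> (\<Sum>i\<in>I. \<Sum>j\<in>I. cmod (E i j) * (cmod (x i) * cmod (x j)))"
    unfolding qform_def
    by (intro sum_norm_le) (simp add: norm_mult mult_ac)
  also have "\<dots> = ?S (\<lambda>i j. cmod (E i j) * (cmod (x i) * cmod (x j)))"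
    by (simp add: sum.cartesian_product)
  also have "\<dots> \<le> sqrt (?S (\<lambda>i j. (cmod (E i j))\<^sup>2) * ?S (\<lambda>i j. (cmod (x i) * cmod (x j))\<^sup>2))"
    using L2_set_mult_ineq[of "\<lambda>(i, j). cmod (E i j)" "\<lambda>(i, j). cmod (x i) * cmod (x j)" "I \<times> I"]
    by (simp add: case_prod_unfold L2_set_def real_sqrt_mult abs_mult)
  also have "?S (\<lambda>i j. (cmod (x i) * cmod (x j))\<^sup>2) = (\<Sum>i\<in>I. (cmod (x i))\<^sup>2)\<^sup>2"
    by (simp add: sum.cartesian_product[symmetric] power_mult_distrib sum_product power2_eq_square mult_ac)
  also have "sqrt (?S (\<lambda>i j. (cmod (E i j))\<^sup>2) * (\<Sum>i\<in>I. (cmod (x i))\<^sup>2)\<^sup>2)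
      = sqrt (?S (\<lambda>i j. (cmod (E i j))\<^sup>2)) * (\<Sum>i\<in>I. (cmod (x i))\<^sup>2)"
    by (simp add: real_sqrt_mult sum_nonneg)
  finally show ?thesis
    by (simp add: sum.cartesian_product)
qed

lemma qform_one:
  assumes "finite I"
  shows "qform I (\<lambda>i j. of_bool (i = j)) x = of_real (\<Sum>i\<in>I. (cmod (x i))\<^sup>2)"
proof -
  have "qform I (\<lambda>i j. of_bool (i = j)) x = (\<Sum>i\<in>I. \<Sum>j\<in>I. if i = j then cnj (x i) * x j else 0)"
    unfolding qform_def by (intro sum.cong refl) simp
  also have "\<dots> = (\<Sum>i\<in>I. of_real ((cmod (x i))\<^sup>2))"
    unfolding complex_norm_square using assms by (simp add: mult.commute)
  finally show ?thesis
    by simp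
qed

text \<open>\<open>E\<close> is dominated by its Hilbert-Schmidt norm times the identity. This
  supplies both a feasible primal point and the repair of a nearly feasible dual one.\<close>

lemma psd_shift:
  assumes "finite I" "\<And>i j. i \<in> I \<Longrightarrow> j \<in> I \<Longrightarrow> E j i = cnj (E i j)"
    and "sqrt (\<Sum>i\<in>I. \<Sum>j\<in>I. (cmod (E i j))\<^sup>2) \<le> c"
  shows "psd I (\<lambda>i j. of_real c * of_bool (i = j) - E i j)"
proof (rule psdI)
  show "of_real c * of_bool (j = i) - E j i = cnj (of_real c * of_bool (i = j) - E i j)"
    if "i \<in> I" "j \<in> I" for i j
    using assms(2)[OF that] by auto
  show "0 \<le> Re (qform I (\<lambda>i j. of_real c * of_bool (i = j) - E i j) x)" for x
  proof -
    have "Re (qform I E x) \<le> sqrt (\<Sum>i\<in>I. \<Sum>j\<in>I. (cmod (E i j))\<^sup>2) * (\<Sum>i\<in>I. (cmod (x i))\<^sup>2)"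
      by (rule qform_bound[OF assms(1)])
    also have "\<dots> \<le> c * (\<Sum>i\<in>I. (cmod (x i))\<^sup>2)"
      using assms(3) by (intro mult_right_mono) (auto intro: sum_nonneg)
    finally show ?thesis
      unfolding qform_diff qform_scale qform_one[OF assms(1)] by simp
  qed
qed

lemma psd_one: "finite I \<Longrightarrow> psd I (\<lambda>i j. of_bool (i = j))"
  using psd_shift[of I "\<lambda>_ _. 0" 1] by simp

subsection \<open>Separation from a convex cone\<close>

text \<open>Divide by \<open>t\<close> and let \<open>t\<close> tend to 0. It serves as first-order
  optimality condition in \<open>cone_separation\<close> and removes the slack in
  \<open>cost_tensor_kernel\<close>.\<close>

lemma nonpos_of_quadratic_bound:
  fixes a b :: real
  assumes "\<And>t. 0 < t \<Longrightarrow> t \<le> 1 \<Longrightarrow> t * a \<le> t\<^sup>2 * b"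
  shows "a \<le> 0"
proof (rule ccontr)
  assume "\<not> a \<le> 0"
  then have a: "a > 0"
    by simp
  \<comment> \<open>Chosen so that \<open>t * (\<bar>b\<bar> + 1)\<close> is at most
    \<open>a / 2\<close>, with \<open>min 1\<close> keeping \<open>t\<close> in the allowed
    range.\<close>
  define t where "t = min 1 (a / (2 * (\<bar>b\<bar> + 1)))"
  have t: "0 < t" "t \<le> 1" "t \<le> a / (2 * (\<bar>b\<bar> + 1))"
    using a by (auto simp: t_def)
  have "t * a \<le> t * (t * b)"
    using assms[OF t(1,2)] by (simp add: power2_eq_square mult_ac)
  then have "a \<le> t * b"
    using t by simp
  also have "\<dots> \<le> t * (\<bar>b\<bar> + 1)"
    using t by (intro mult_left_mono) auto
  also have "\<dots> \<le> a / (2 * (\<bar>b\<bar> + 1)) * (\<bar>b\<bar> + 1)"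
    using t by (intro mult_right_mono) auto
  also have "\<dots> = a / 2"
    by (simp add: field_simps)
  finally show False
    using a by simp
qed

text \<open>The cone need not be closed, so a nearest point may be missing. The residuals
  \<open>p - w\<close> of a minimizing sequence still converge, and comparing with moves inside the
  cone gives the sign of the limit on the cone and at \<open>p\<close>.\<close>

lemma cone_separation:
  fixes S :: "('j \<Rightarrow> complex) set" and p :: "'j \<Rightarrow> complex"
  assumes J: "finite J" and ne: "S \<noteq> {}"
    and add: "\<And>u v. u \<in> S \<Longrightarrow> v \<in> S \<Longrightarrow> (\<lambda>j. u j + v j) \<in> S"
    and scale: "\<And>u t. u \<in> S \<Longrightarrow> 0 \<le> t \<Longrightarrow> (\<lambda>j. complex_of_real t * u j) \<in> S"
    and far: "0 < \<delta>" "\<And>u. u \<in> S \<Longrightarrow> \<delta> \<le> (\<Sum>j\<in>J. (cmod (p j - u j))\<^sup>2)"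
  shows "\<exists>y. (\<forall>u\<in>S. Re (\<Sum>j\<in>J. cnj (y j) * u j) \<le> 0) \<and> 0 < Re (\<Sum>j\<in>J. cnj (y j) * p j)"
proof -
  define N where "N = (\<lambda>v :: 'j \<Rightarrow> complex. \<Sum>j\<in>J. (cmod (v j))\<^sup>2)"
  define ip where "ip = (\<lambda>u v :: 'j \<Rightarrow> complex. Re (\<Sum>j\<in>J. cnj (u j) * v j))"
  have N_nonneg: "N v \<ge> 0" for v
    by (simp add: N_def sum_nonneg)
  have N_add: "N (\<lambda>j. u j + of_real t * v j) = N u + 2 * t * ip u v + t\<^sup>2 * N v" for u v t
  proof -
    have "(cmod (u j + of_real t * v j))\<^sup>2
        = (cmod (u j))\<^sup>2 + 2 * t * Re (cnj (u j) * v j) + t\<^sup>2 * (cmod (v j))\<^sup>2" for j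
      unfolding cmod_power2 by (simp add: power2_eq_square algebra_simps)
    then show ?thesis
      unfolding N_def ip_def by (simp only: sum.distrib sum_distrib_left Re_sum)
  qed
  define m where "m = (INF u\<in>S. N (\<lambda>j. p j - u j))"
  have bdd: "bdd_below ((\<lambda>u. N (\<lambda>j. p j - u j)) ` S)"
    using N_nonneg by (intro bdd_belowI2[of _ 0])
  have m_le: "m \<le> N (\<lambda>j. p j - u j)" if "u \<in> S" for u
    unfolding m_def by (rule cINF_lower[OF bdd that])
  have m_pos: "m > 0"
  proof -
    have "\<delta> \<le> m"
      unfolding m_def using far(2) by (intro cINF_greatest[OF ne]) (simp add: N_def)
    then show ?thesis
      using far(1) by simp
  qed
  have "\<exists>u\<in>S. N (\<lambda>j. p j - u j) < m + inverse (real (Suc n))" for n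
    using cInf_lessD[of "(\<lambda>u. N (\<lambda>j. p j - u j)) ` S" "m + inverse (real (Suc n))"] ne
    unfolding m_def by auto
  then obtain w where w: "\<And>n. w n \<in> S" "\<And>n. N (\<lambda>j. p j - w n j) < m + inverse (real (Suc n))"
    by metis
  \<comment> \<open>The residuals \<open>r n\<close> of a minimizing sequence form a Cauchy sequence by the parallelogram law;
    their limit separates.\<close>
  define r where "r = (\<lambda>n j. p j - w n j)"
  have diff: "N (\<lambda>j. r n j - r k j) \<le> 2 * inverse (real (Suc n)) + 2 * inverse (real (Suc k))" for n k
  proof -
    \<comment> \<open>The midpoint lies in the cone, so its squared distance to \<open>p\<close> is
      at least \<open>m\<close>; this bounds the sum of the two residuals from below.\<close>
    have mid: "(\<lambda>j. complex_of_real (1 / 2) * (w n j + w k j)) \<in> S"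
      using w(1) by (intro scale add) auto
    have "4 * N (\<lambda>j. p j - of_real (1 / 2) * (w n j + w k j)) = N (\<lambda>j. r n j + r k j)"
      unfolding N_def sum_distrib_left
    proof (intro sum.cong refl)
      fix j
      have "r n j + r k j = 2 * (p j - of_real (1 / 2) * (w n j + w k j))"
        by (simp add: r_def field_simps)
      then show "4 * (cmod (p j - of_real (1 / 2) * (w n j + w k j)))\<^sup>2 = (cmod (r n j + r k j))\<^sup>2"
        by (simp only: norm_mult power_mult_distrib) simp
    qed
    moreover have "N (\<lambda>j. r n j - r k j) + N (\<lambda>j. r n j + r k j) = 2 * N (r n) + 2 * N (r k)"
      using N_add[of "r n" 1 "r k"] N_add[of "r n" "-1" "r k"] by simp
    ultimately show ?thesis
      using m_le[OF mid] w(2)[of n] w(2)[of k] unfolding r_def by linarith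
  qed
  have inv0: "(\<lambda>n. inverse (real (Suc n))) \<longlonglongrightarrow> 0"
    by (rule LIMSEQ_inverse_real_of_nat)
  have "Cauchy (\<lambda>n. r n j)" if "j \<in> J" for j
  proof (rule metric_CauchyI)
    fix e :: real assume "e > 0"
    then have "0 < e\<^sup>2 / 4"
      by simp
    from order_tendstoD(2)[OF inv0 this] obtain M where
      M: "\<And>n. n \<ge> M \<Longrightarrow> inverse (real (Suc n)) < e\<^sup>2 / 4"
      unfolding eventually_sequentially by blast
    have "dist (r n j) (r k j) < e" if "n \<ge> M" "k \<ge> M" for n k
    proof -
      have "(cmod (r n j - r k j))\<^sup>2 \<le> N (\<lambda>j. r n j - r k j)"
        unfolding N_def using J \<open>j \<in> J\<close> by (intro member_le_sum) auto
      also have "\<dots> < e\<^sup>2"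
        using diff[of n k] M[OF that(1)] M[OF that(2)] by linarith
      finally show ?thesis
        using \<open>e > 0\<close> power2_less_imp_less unfolding dist_norm by force
    qed
    then show "\<exists>M. \<forall>n\<ge>M. \<forall>k\<ge>M. dist (r n j) (r k j) < e"
      by blast
  qed
  then have "\<exists>l. (\<lambda>n. r n j) \<longlonglongrightarrow> l" if "j \<in> J" for j
    using that Cauchy_convergent convergent_def by blast
  then obtain y where y: "\<And>j. j \<in> J \<Longrightarrow> (\<lambda>n. r n j) \<longlonglongrightarrow> y j"
    by metis
  have lim_m: "(\<lambda>n. N (r n)) \<longlonglongrightarrow> m"
  proof (rule tendsto_sandwich[of "\<lambda>_. m" _ _ "\<lambda>n. m + inverse (real (Suc n))"])
    show "(\<lambda>n. m + inverse (real (Suc n))) \<longlonglongrightarrow> m"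
      using tendsto_add[OF tendsto_const inv0, of m] by simp
    show "\<forall>\<^sub>F n in sequentially. m \<le> N (r n)"
      using m_le w(1) unfolding r_def by simp
    show "\<forall>\<^sub>F n in sequentially. N (r n) \<le> m + inverse (real (Suc n))"
      using w(2) unfolding r_def by (simp add: less_imp_le)
  qed simp
  have "(\<lambda>n. N (r n)) \<longlonglongrightarrow> N y"
    unfolding N_def by (intro tendsto_intros y)
  with lim_m have Ny: "N y = m"
    using LIMSEQ_unique by blast
  \<comment> \<open>Moving \<open>w n\<close> by \<open>t * u\<close> stays in the cone and cannot
    bring the squared distance below \<open>m\<close>, so the term of first order in
    \<open>t\<close> has the right sign.\<close>
  have le_u: "ip y u \<le> 0" if u: "u \<in> S" for u
  proof (rule nonpos_of_quadratic_bound[of _ "N u / 2"])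
    fix t :: real assume t: "0 < t" "t \<le> 1"
    have "m \<le> N (\<lambda>j. r n j + of_real (- t) * u j)" for n
    proof -
      have "(\<lambda>j. w n j + of_real t * u j) \<in> S"
        using w u t by (intro add scale) auto
      from m_le[OF this] show ?thesis
        by (simp add: r_def algebra_simps)
    qed
    moreover have "(\<lambda>n. N (\<lambda>j. r n j + of_real (- t) * u j)) \<longlonglongrightarrow> N (\<lambda>j. y j + of_real (- t) * u j)"
      unfolding N_def by (intro tendsto_intros y)
    ultimately have "m \<le> N (\<lambda>j. y j + of_real (- t) * u j)"
      using LIMSEQ_le_const by blast
    then show "t * ip y u \<le> t\<^sup>2 * (N u / 2)"
      unfolding N_add Ny by simp
  qed
  \<comment> \<open>Shrinking \<open>w n\<close> by the factor \<open>1 - t\<close> also stays in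
    the cone. It yields that \<open>ip y p\<close> is at least \<open>N y = m\<close>, which is
    positive.\<close>
  have "- ip y (\<lambda>j. p j - y j) \<le> 0"
  proof (rule nonpos_of_quadratic_bound[of _ "N (\<lambda>j. p j - y j) / 2"])
    fix t :: real assume t: "0 < t" "t \<le> 1"
    have "m \<le> N (\<lambda>j. r n j + of_real t * (p j - r n j))" for n
    proof -
      have "(\<lambda>j. of_real (1 - t) * w n j) \<in> S"
        using w t by (intro scale) auto
      from m_le[OF this] show ?thesis
        by (simp add: r_def algebra_simps)
    qed
    moreover have "(\<lambda>n. N (\<lambda>j. r n j + of_real t * (p j - r n j)))
        \<longlonglongrightarrow> N (\<lambda>j. y j + of_real t * (p j - y j))"
      unfolding N_def by (intro tendsto_intros y)
    ultimately have "m \<le> N (\<lambda>j. y j + of_real t * (p j - y j))"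
      using LIMSEQ_le_const by blast
    then show "t * - ip y (\<lambda>j. p j - y j) \<le> t\<^sup>2 * (N (\<lambda>j. p j - y j) / 2)"
      unfolding N_add Ny by simp
  qed
  moreover have "ip y (\<lambda>j. p j - y j) = ip y p - N y"
    unfolding ip_def N_def cmod_power2 Re_sum sum_subtractf[symmetric]
    by (intro sum.cong refl) (simp add: power2_eq_square algebra_simps)
  ultimately have "0 < ip y p"
    using m_pos Ny by simp
  with le_u show ?thesis
    unfolding ip_def by blast
qed

subsection \<open>The semidefinite program of the min-entropy\<close>

definition ktrace :: "'i set \<Rightarrow> ('i \<Rightarrow> 'i \<Rightarrow> complex) \<Rightarrow> complex" where
  "ktrace I M = (\<Sum>i\<in>I. M i i)"

text \<open>The kernel of \<open>id \<otimes> Y\<close>.\<close>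

definition amplify :: "('b \<Rightarrow> 'b \<Rightarrow> complex) \<Rightarrow> 'a \<times> 'b \<Rightarrow> 'a \<times> 'b \<Rightarrow> complex" where
  "amplify Y = (\<lambda>(a, b) (a', b'). of_bool (a = a') * Y b b')"

definition ptrace :: "'a set \<Rightarrow> ('a \<times> 'b \<Rightarrow> 'a \<times> 'b \<Rightarrow> complex) \<Rightarrow> 'b \<Rightarrow> 'b \<Rightarrow> complex" where
  "ptrace A X = (\<lambda>b b'. \<Sum>a\<in>A. X (a, b) (a, b'))"

text \<open>Positivity of \<open>Y\<close> is a consequence, drawn in \<open>feasible_psd\<close>
  from \<open>R\<close> positive and \<open>A\<close> nonempty.\<close>

definition feasible ::
  "'a set \<Rightarrow> 'b set \<Rightarrow> ('a \<times> 'b \<Rightarrow> 'a \<times> 'b \<Rightarrow> complex) \<Rightarrow> ('b \<Rightarrow> 'b \<Rightarrow> complex) \<Rightarrow> bool" where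
  "feasible A B R Y \<longleftrightarrow> psd (A \<times> B) (\<lambda>p q. amplify Y p q - R p q)"

definition dual_feasible ::
  "'a set \<Rightarrow> 'b set \<Rightarrow> ('a \<times> 'b \<Rightarrow> 'a \<times> 'b \<Rightarrow> complex) \<Rightarrow> bool" where
  "dual_feasible A B X \<longleftrightarrow> psd (A \<times> B) X \<and> psd B (\<lambda>b b'. of_bool (b = b') - ptrace A X b b')"

text \<open>The normalization of \<open>\<sigma>\<close> is absorbed into \<open>Y\<close>: for a density operator, \<open>cost\<close> is
  \<open>2 powr - H_min\<close>. The infimum is over a nonempty set bounded below when \<open>R\<close> is positive
  semidefinite and \<open>A\<close> is nonempty.\<close>

definition cost :: "'a set \<Rightarrow> 'b set \<Rightarrow> ('a \<times> 'b \<Rightarrow> 'a \<times> 'b \<Rightarrow> complex) \<Rightarrow> real" where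
  "cost A B R = (INF Y\<in>{Y. feasible A B R Y}. Re (ktrace B Y))"

lemma sum_Times: "sum f (A \<times> B) = (\<Sum>a\<in>A. \<Sum>b\<in>B. f (a, b))"
  by (simp add: sum.cartesian_product)

lemma ktrace_diff: "ktrace I (\<lambda>i j. M i j - N i j) = ktrace I M - ktrace I N"
  by (simp add: ktrace_def sum_subtractf)

lemma ktrace_scale: "ktrace I (\<lambda>i j. c * M i j) = c * ktrace I M"
  by (simp add: ktrace_def sum_distrib_left)

lemma ktrace_psd_nonneg:
  assumes "finite I" "psd I M"
  shows "0 \<le> Re (ktrace I M)"
  unfolding ktrace_def using psd_diag(1)[OF assms(2,1)] by (simp add: sum_nonneg)

lemma ktrace_amplify: "ktrace (A \<times> B) (amplify Y) = of_nat (card A) * ktrace B Y"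
  by (simp add: ktrace_def amplify_def sum_Times)

lemma ktrace_reindex: "bij_betw f I J \<Longrightarrow> ktrace I (\<lambda>i j. M (f i) (f j)) = ktrace J M"
  unfolding ktrace_def by (rule sum.reindex_bij_betw[of f I J "\<lambda>i. M i i"])

lemma pairing_diff_left: "pairing I (\<lambda>i j. M i j - N i j) X = pairing I M X - pairing I N X"
  by (simp add: pairing_def sum_subtractf algebra_simps)

lemma pairing_diff_right: "pairing I M (\<lambda>i j. X i j - Y i j) = pairing I M X - pairing I M Y"
  by (simp add: pairing_def sum_subtractf algebra_simps)

lemma pairing_add_right: "pairing I M (\<lambda>i j. X i j + Y i j) = pairing I M X + pairing I M Y"
  by (simp add: pairing_def sum.distrib algebra_simps)

lemma pairing_scale_right: "pairing I M (\<lambda>i j. c * X i j) = c * pairing I M X"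
  by (simp add: pairing_def sum_distrib_left algebra_simps)

lemma pairing_one:
  assumes "finite I"
  shows "pairing I M (\<lambda>i j. of_bool (i = j)) = ktrace I M"
proof -
  have "pairing I M (\<lambda>i j. of_bool (i = j)) = (\<Sum>i\<in>I. \<Sum>j\<in>I. if i = j then M i j else 0)"
    unfolding pairing_def by (intro sum.cong refl) simp
  then show ?thesis
    using assms by (simp add: ktrace_def)
qed

lemma pairing_tensor:
  "pairing (I \<times> J) (\<lambda>(i, j) (k, l). M i k * N j l) (\<lambda>(i, j) (k, l). X i k * Y j l)
    = pairing I M X * pairing J N Y"
proof -
  have "pairing (I \<times> J) (\<lambda>(i, j) (k, l). M i k * N j l) (\<lambda>(i, j) (k, l). X i k * Y j l)
      = (\<Sum>i\<in>I. \<Sum>j\<in>J. \<Sum>k\<in>I. \<Sum>l\<in>J. (M i k * X k i) * (N j l * Y l j))"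
    unfolding pairing_def sum_Times by (intro sum.cong refl) (simp add: mult_ac)
  also have "\<dots> = pairing I M X * pairing J N Y"
    unfolding pairing_def sum_product by (intro sum.cong refl)
  finally show ?thesis .
qed

lemma pairing_reindex:
  assumes "bij_betw f I J"
  shows "pairing I (\<lambda>i j. M (f i) (f j)) (\<lambda>i j. X (f i) (f j)) = pairing J M X"
proof -
  have "pairing I (\<lambda>i j. M (f i) (f j)) (\<lambda>i j. X (f i) (f j)) = (\<Sum>i\<in>I. \<Sum>j\<in>J. M (f i) j * X j (f i))"
    unfolding pairing_def
    by (rule sum.cong[OF refl], rule sum.reindex_bij_betw[OF assms, of "\<lambda>j. M (f _) j * X j (f _)"])
  also have "\<dots> = pairing J M X"
    unfolding pairing_def by (rule sum.reindex_bij_betw[OF assms, of "\<lambda>i. \<Sum>j\<in>J. M i j * X j i"])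
  finally show ?thesis .
qed

text \<open>The partial trace over \<open>A\<close> is adjoint to \<open>amplify\<close>; this turns
  the constraint of the primal into that of the dual.\<close>

lemma pairing_amplify:
  assumes "finite A"
  shows "pairing (A \<times> B) (amplify Y) X = pairing B Y (ptrace A X)"
proof -
  have "pairing (A \<times> B) (amplify Y) X
      = (\<Sum>a\<in>A. \<Sum>b\<in>B. \<Sum>a'\<in>A. if a = a' then \<Sum>b'\<in>B. Y b b' * X (a, b') (a, b) else 0)"
    unfolding pairing_def sum_Times amplify_def
    by (intro sum.cong refl) simp
  also have "\<dots> = (\<Sum>a\<in>A. \<Sum>b\<in>B. \<Sum>b'\<in>B. Y b b' * X (a, b') (a, b))"
    using assms by simp
  also have "\<dots> = (\<Sum>b\<in>B. \<Sum>b'\<in>B. \<Sum>a\<in>A. Y b b' * X (a, b') (a, b))"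
    by (rule sum_rotate[symmetric])
  finally show ?thesis
    by (simp add: pairing_def ptrace_def sum_distrib_left)
qed

text \<open>The block at a fixed \<open>a\<close> is a principal submatrix. Such blocks recover
  \<open>Y\<close> from \<open>amplify Y\<close> and add up to the partial trace.\<close>

lemma psd_slice:
  assumes "finite A" "finite B" "a \<in> A" "psd (A \<times> B) X"
  shows "psd B (\<lambda>b b'. X (a, b) (a, b'))"
proof -
  have "psd ({a} \<times> B) X"
    by (rule psd_subset[OF assms(4)]) (use assms in auto)
  moreover have "bij_betw (Pair a) B ({a} \<times> B)"
    by (auto simp: bij_betw_def inj_on_def)
  ultimately show ?thesis
    using psd_reindex[of "Pair a" B "{a} \<times> B" X] by blast
qed

lemma psd_of_amplify:
  assumes "finite A" "finite B" "A \<noteq> {}" "psd (A \<times> B) (amplify Y)"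
  shows "psd B Y"
proof -
  obtain a where "a \<in> A"
    using assms(3) by blast
  from psd_slice[OF assms(1,2) this assms(4)] show ?thesis
    by (simp add: amplify_def)
qed

lemma psd_sum:
  assumes "finite A" "\<And>a. a \<in> A \<Longrightarrow> psd I (M a)"
  shows "psd I (\<lambda>i j. \<Sum>a\<in>A. M a i j)"
  using assms
proof (induction A)
  case empty
  show ?case
    by (rule psdI) (simp_all add: qform_def)
next
  case (insert a A)
  then show ?case
    using psd_add[of I "M a" "\<lambda>i j. \<Sum>a\<in>A. M a i j"] by simp
qed

lemma psd_ptrace:
  assumes "finite A" "finite B" "psd (A \<times> B) X"
  shows "psd B (ptrace A X)"
  unfolding ptrace_def using psd_slice[OF assms(1,2) _ assms(3)] by (intro psd_sum[OF assms(1)])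

section \<open>Feasible points, weak duality and bounds on the cost\<close>

lemma feasible_psd:
  assumes "finite A" "finite B" "A \<noteq> {}" "psd (A \<times> B) R" "feasible A B R Y"
  shows "psd (A \<times> B) (amplify Y)" "psd B Y"
proof -
  show "psd (A \<times> B) (amplify Y)"
    using psd_add[OF assms(5)[unfolded feasible_def] assms(4)] by simp
  then show "psd B Y"
    by (rule psd_of_amplify[OF assms(1-3)])
qed

text \<open>A multiple of the identity dominates \<open>R\<close>, so the infimum in
  \<open>cost\<close> is over a nonempty set.\<close>

lemma feasible_exists:
  assumes "finite A" "finite B" "psd (A \<times> B) R"
  shows "\<exists>Y. feasible A B R Y"
proof -
  define c where "c = sqrt (\<Sum>p\<in>A \<times> B. \<Sum>q\<in>A \<times> B. (cmod (R p q))\<^sup>2)"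
  have "psd (A \<times> B) (\<lambda>p q. of_real c * of_bool (p = q) - R p q)"
    using assms unfolding c_def by (intro psd_shift psd_hermitian) auto
  moreover have "of_real c * of_bool (p = q) = amplify (\<lambda>b b'. of_real c * of_bool (b = b')) p q"
    for p q :: "'a \<times> 'b"
    by (cases p; cases q) (auto simp: amplify_def)
  ultimately show ?thesis
    unfolding feasible_def by auto
qed

text \<open>The chain is \<open>tr R X \<le> tr (id \<otimes> Y) X = tr Y (tr_A X) \<le> tr
  Y\<close>, where each inequality pairs two positive kernels.\<close>

lemma weak_duality:
  assumes "finite A" "finite B" "A \<noteq> {}" "psd (A \<times> B) R" "feasible A B R Y" "dual_feasible A B X"
  shows "Re (pairing (A \<times> B) R X) \<le> Re (ktrace B Y)"
proof -
  have X: "psd (A \<times> B) X" "psd B (\<lambda>b b'. of_bool (b = b') - ptrace A X b b')"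
    using assms(6) by (auto simp: dual_feasible_def)
  have fin: "finite (A \<times> B)"
    using assms by simp
  have "0 \<le> Re (pairing (A \<times> B) (amplify Y) X) - Re (pairing (A \<times> B) R X)"
    using pairing_psd_nonneg[OF fin assms(5)[unfolded feasible_def] X(1)]
    by (simp add: pairing_diff_left)
  moreover have "0 \<le> Re (ktrace B Y) - Re (pairing B Y (ptrace A X))"
    using pairing_psd_nonneg[OF assms(2) feasible_psd(2)[OF assms(1-5)] X(2)]
    by (simp add: pairing_diff_right pairing_one[OF assms(2)])
  ultimately show ?thesis
    by (simp add: pairing_amplify[OF assms(1)])
qed

text \<open>Traces are taken in the constraint. Through \<open>ktrace_le_cost\<close> this keeps the
  cost of a density operator positive and settles the degenerate case of the separation
  argument.\<close>

lemma ktrace_le_feasible: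
  assumes "finite A" "finite B" "feasible A B R Y"
  shows "Re (ktrace (A \<times> B) R) \<le> card A * Re (ktrace B Y)"
  using ktrace_psd_nonneg[OF _ assms(3)[unfolded feasible_def]] assms(1,2)
  by (simp add: ktrace_diff ktrace_amplify)

lemma cost_le:
  assumes "finite A" "finite B" "A \<noteq> {}" "psd (A \<times> B) R" "feasible A B R Y"
  shows "cost A B R \<le> Re (ktrace B Y)"
  unfolding cost_def
proof (rule cINF_lower)
  show "bdd_below ((\<lambda>Y. Re (ktrace B Y)) ` {Y. feasible A B R Y})"
    using ktrace_psd_nonneg[OF assms(2) feasible_psd(2)[OF assms(1-4)]] by (intro bdd_belowI2[of _ 0]) simp
qed (use assms in simp)

lemma le_costI:
  assumes "finite A" "finite B" "psd (A \<times> B) R"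
    and "\<And>Y. feasible A B R Y \<Longrightarrow> c \<le> Re (ktrace B Y)"
  shows "c \<le> cost A B R"
  unfolding cost_def using feasible_exists[OF assms(1-3)] assms(4) by (intro cINF_greatest) auto

lemma cost_less_feasible:
  assumes "finite A" "finite B" "psd (A \<times> B) R" "cost A B R < c"
  obtains Y where "feasible A B R Y" "Re (ktrace B Y) < c"
  using assms(4) cInf_lessD[of "(\<lambda>Y. Re (ktrace B Y)) ` {Y. feasible A B R Y}" c]
    feasible_exists[OF assms(1-3)] unfolding cost_def by auto

lemma ktrace_le_cost:
  assumes "finite A" "finite B" "A \<noteq> {}" "psd (A \<times> B) R"
  shows "Re (ktrace (A \<times> B) R) \<le> card A * cost A B R"
proof -
  have "Re (ktrace (A \<times> B) R) / card A \<le> cost A B R"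
    using ktrace_le_feasible[OF assms(1,2), of R] assms
    by (intro le_costI) (auto simp: field_simps card_gt_0_iff)
  then show ?thesis
    using assms by (simp add: field_simps card_gt_0_iff)
qed

lemma cost_nonneg:
  assumes "finite A" "finite B" "A \<noteq> {}" "psd (A \<times> B) R"
  shows "0 \<le> cost A B R"
  using ktrace_psd_nonneg[OF assms(2) feasible_psd(2)[OF assms(1-4)]] assms by (intro le_costI) auto

text \<open>Otherwise the pair \<open>(id, cost)\<close> would have positive distance from the cone of all pairs
  \<open>(tr\<^sub>A X, tr R X)\<close> with \<open>X \<ge> 0\<close>, and a separating functional, rescaled by its last
  component \<open>t\<close>, would be a feasible \<open>Y\<close> below the infimum; \<open>t \<le> 0\<close> is excluded by taking
  traces.\<close>

lemma strong_duality:
  fixes A :: "'a set" and B :: "'b set"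
  assumes A: "finite A" "A \<noteq> {}" and B: "finite B" and R: "psd (A \<times> B) R" and "0 < \<epsilon>"
  shows "\<exists>X. dual_feasible A B X \<and> cost A B R - \<epsilon> \<le> Re (pairing (A \<times> B) R X)"
proof -
  define \<alpha> where "\<alpha> = cost A B R"
  have fin: "finite (A \<times> B)"
    using A B by simp
  \<comment> \<open>One index set for pairs of a number and a kernel on \<open>B\<close>:
    \<open>None\<close> holds the number, \<open>Some (b, b')\<close> a matrix entry.\<close>
  define J :: "('b \<times> 'b) option set" where "J = insert None (Some ` (B \<times> B))"
  have J: "finite J"
    using B by (simp add: J_def)
  have sumJ: "sum f J = f None + (\<Sum>b\<in>B. \<Sum>b'\<in>B. f (Some (b, b')))" for f :: "_ \<Rightarrow> 'c :: comm_monoid_add"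
    using B unfolding J_def by (simp add: sum.reindex sum.cartesian_product)
  define vec :: "('a \<times> 'b \<Rightarrow> 'a \<times> 'b \<Rightarrow> complex) \<Rightarrow> ('b \<times> 'b) option \<Rightarrow> complex" where
    "vec = (\<lambda>X j. case j of None \<Rightarrow> of_real (Re (pairing (A \<times> B) R X)) | Some (b, b') \<Rightarrow> ptrace A X b b')"
  define S where "S = vec ` {X. psd (A \<times> B) X}"
  define p :: "('b \<times> 'b) option \<Rightarrow> complex" where
    "p = (\<lambda>j. case j of None \<Rightarrow> of_real \<alpha> | Some (b, b') \<Rightarrow> of_bool (b = b'))"
  have add: "(\<lambda>j. u j + v j) \<in> S" if "u \<in> S" "v \<in> S" for u v
  proof -
    from that obtain X X' where X: "psd (A \<times> B) X" "psd (A \<times> B) X'" "u = vec X" "v = vec X'"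
      by (auto simp: S_def)
    have "(\<lambda>j. u j + v j) = vec (\<lambda>p q. X p q + X' p q)"
      by (rule ext) (auto simp: X vec_def pairing_add_right ptrace_def sum.distrib split: option.split)
    then show ?thesis
      using psd_add[OF X(1,2)] by (auto simp: S_def)
  qed
  have scale: "(\<lambda>j. complex_of_real t * u j) \<in> S" if "u \<in> S" "0 \<le> t" for u t
  proof -
    from that obtain X where X: "psd (A \<times> B) X" "u = vec X"
      by (auto simp: S_def)
    have "(\<lambda>j. complex_of_real t * u j) = vec (\<lambda>p q. complex_of_real t * X p q)"
      by (rule ext)
        (auto simp: X vec_def pairing_scale_right ptrace_def sum_distrib_left split: option.split)
    then show ?thesis
      using psd_scale[OF X(1) that(2)] by (auto simp: S_def)
  qed
  have "psd (A \<times> B) (\<lambda>_ _. 0)"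
    by (rule psdI) (simp_all add: qform_def)
  then have ne: "S \<noteq> {}"
    by (auto simp: S_def)
  have near: "\<exists>X. psd (A \<times> B) X \<and> (\<Sum>j\<in>J. (cmod (p j - vec X j))\<^sup>2) < \<delta>" if \<delta>: "\<delta> > 0" for \<delta>
  proof (rule ccontr)
    assume contra: "\<not> ?thesis"
    have "\<exists>y. (\<forall>u\<in>S. Re (\<Sum>j\<in>J. cnj (y j) * u j) \<le> 0) \<and> 0 < Re (\<Sum>j\<in>J. cnj (y j) * p j)"
      by (rule cone_separation[OF J ne add scale \<delta>]) (use contra in \<open>auto simp: S_def not_less\<close>)
    then obtain y where yS: "\<And>X. psd (A \<times> B) X \<Longrightarrow> Re (\<Sum>j\<in>J. cnj (y j) * vec X j) \<le> 0"
      and yp: "0 < Re (\<Sum>j\<in>J. cnj (y j) * p j)"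
      by (auto simp: S_def)
    define t where "t = Re (y None)"
    \<comment> \<open>Minus the Hermitian part of the \<open>B\<close> block of \<open>y\<close>:
      positive kernels have Hermitian partial traces, so only this part affects the real functional.
      The sign turns the upper bound on the cone into positivity.\<close>
    define Y where "Y = (\<lambda>b b'. - (y (Some (b, b')) + cnj (y (Some (b', b)))) / 2)"
    have qY: "Re (qform (A \<times> B) (amplify Y) x)
        = - Re (\<Sum>b\<in>B. \<Sum>b'\<in>B. cnj (y (Some (b, b'))) * (\<Sum>a\<in>A. x (a, b) * cnj (x (a, b'))))" for x
    proof -
      define Z where "Z = (\<lambda>p q. x p * cnj (x q))"
      define G where "G = (\<Sum>b\<in>B. \<Sum>b'\<in>B. cnj (y (Some (b, b'))) * ptrace A Z b b')"
      have "qform (A \<times> B) (amplify Y) x = pairing (A \<times> B) (amplify Y) Z"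
        unfolding qform_def pairing_def Z_def by (intro sum.cong refl) (simp add: mult_ac)
      also have "\<dots> = pairing B Y (ptrace A Z)"
        by (rule pairing_amplify[OF A(1)])
      also have "\<dots> = - 1 / 2 * ((\<Sum>b\<in>B. \<Sum>b'\<in>B. y (Some (b, b')) * ptrace A Z b' b)
          + (\<Sum>b\<in>B. \<Sum>b'\<in>B. cnj (y (Some (b', b))) * ptrace A Z b' b))"
        unfolding pairing_def Y_def sum.distrib[symmetric] sum_distrib_left
        by (intro sum.cong refl) (simp add: field_simps)
      also have "(\<Sum>b\<in>B. \<Sum>b'\<in>B. cnj (y (Some (b', b))) * ptrace A Z b' b) = G"
        unfolding G_def by (rule sum.swap)
      also have "(\<Sum>b\<in>B. \<Sum>b'\<in>B. y (Some (b, b')) * ptrace A Z b' b)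
          = cnj G"
        unfolding G_def cnj_sum by (intro sum.cong refl) (simp add: ptrace_def Z_def mult.commute)
      finally show ?thesis
        by (simp add: G_def[symmetric, unfolded ptrace_def Z_def])
    qed
    have main: "psd (A \<times> B) (\<lambda>p q. amplify Y p q - of_real t * R p q)"
    proof (rule psdI)
      fix p q assume pq: "p \<in> A \<times> B" "q \<in> A \<times> B"
      show "amplify Y q p - of_real t * R q p = cnj (amplify Y p q - of_real t * R p q)"
        using psd_hermitian[OF R pq] by (cases p; cases q) (simp add: amplify_def Y_def eq_commute[of "fst p"])
    next
      fix x :: "'a \<times> 'b \<Rightarrow> complex"
      \<comment> \<open>Testing the functional on the rank-one kernel of \<open>x\<close> produces
        the quadratic forms at \<open>x\<close>.\<close>
      define Z where "Z = (\<lambda>p q. x p * cnj (x q))"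
      have Z: "psd (A \<times> B) Z"
        using psd_gram[of "A \<times> B" "\<lambda>p _. x p" "{()}"] unfolding Z_def by simp
      have "pairing (A \<times> B) R Z = qform (A \<times> B) R x"
        unfolding qform_def pairing_def Z_def by (intro sum.cong refl) (simp add: mult_ac)
      then have "Re (\<Sum>j\<in>J. cnj (y j) * vec Z j)
          = t * Re (qform (A \<times> B) R x) - Re (qform (A \<times> B) (amplify Y) x)"
        unfolding sumJ qY by (simp add: vec_def t_def ptrace_def Z_def)
      then show "0 \<le> Re (qform (A \<times> B) (\<lambda>p q. amplify Y p q - of_real t * R p q) x)"
        using yS[OF Z] by (simp add: qform_diff qform_scale)
    qed
    have "(\<Sum>b\<in>B. \<Sum>b'\<in>B. cnj (y (Some (b, b'))) * p (Some (b, b')))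
        = (\<Sum>b\<in>B. \<Sum>b'\<in>B. if b = b' then cnj (y (Some (b, b'))) else 0)"
      by (intro sum.cong refl) (simp add: p_def)
    then have "Re (\<Sum>j\<in>J. cnj (y j) * p j)
        = t * \<alpha> + Re (\<Sum>b\<in>B. \<Sum>b'\<in>B. if b = b' then cnj (y (Some (b, b'))) else 0)"
      unfolding sumJ by (simp only: plus_complex.sel) (simp add: p_def t_def)
    also have "\<dots> = t * \<alpha> - Re (ktrace B Y)"
      using B by (simp add: ktrace_def Y_def sum_negf)
    finally have trY: "Re (ktrace B Y) < t * \<alpha>"
      using yp by simp
    show False
    proof (cases "t > 0")
      case True
      have "feasible A B R (\<lambda>b b'. of_real (1 / t) * Y b b')"
        unfolding feasible_def
      proof (rule psd_scale_cancel[OF _ True])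
        have "of_real t * (amplify (\<lambda>b b'. of_real (1 / t) * Y b b') p q - R p q)
            = amplify Y p q - of_real t * R p q" for p q
          using True by (cases p; cases q) (simp add: amplify_def algebra_simps)
        then show "psd (A \<times> B)
            (\<lambda>p q. of_real t * (amplify (\<lambda>b b'. of_real (1 / t) * Y b b') p q - R p q))"
          using main by simp
      qed
      from cost_le[OF A(1) B A(2) R this] have "\<alpha> \<le> Re (ktrace B Y) / t"
        unfolding ktrace_scale \<alpha>_def by simp
      then show False
        using trY True by (simp add: field_simps)
    next
      case False
      have "0 \<le> card A * Re (ktrace B Y) - t * Re (ktrace (A \<times> B) R)"
        using ktrace_psd_nonneg[OF fin main] by (simp add: ktrace_diff ktrace_scale ktrace_amplify)
      moreover have "t * (card A * \<alpha>) \<le> t * Re (ktrace (A \<times> B) R)"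
        using ktrace_le_cost[OF A(1) B A(2) R] False unfolding \<alpha>_def by (intro mult_left_mono_neg) auto
      ultimately have "card A * (t * \<alpha>) \<le> card A * Re (ktrace B Y)"
        by (simp add: mult_ac)
      then show False
        using trY A by (simp add: card_gt_0_iff mult_le_cancel_left)
    qed
  qed
  have \<alpha>: "\<alpha> \<ge> 0"
    unfolding \<alpha>_def by (rule cost_nonneg[OF A(1) B A(2) R])
  \<comment> \<open>The equation \<open>d + d * \<alpha> = \<epsilon>\<close> covers the error
    \<open>d\<close> in the value and the loss from dividing by \<open>1 + d\<close>.\<close>
  define d where "d = \<epsilon> / (1 + \<alpha>)"
  have d: "d > 0" "d * (1 + \<alpha>) = \<epsilon>"
    using \<alpha> \<open>0 < \<epsilon>\<close> by (simp_all add: d_def)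
  from near[of "d\<^sup>2"] d obtain X where X: "psd (A \<times> B) X" "(\<Sum>j\<in>J. (cmod (p j - vec X j))\<^sup>2) < d\<^sup>2"
    by auto
  define E where "E = (\<lambda>b b'. of_bool (b = b') - ptrace A X b b')"
  define e where "e = \<alpha> - Re (pairing (A \<times> B) R X)"
  have split: "(\<Sum>j\<in>J. (cmod (p j - vec X j))\<^sup>2) = e\<^sup>2 + (\<Sum>b\<in>B. \<Sum>b'\<in>B. (cmod (E b b'))\<^sup>2)"
    unfolding sumJ by (simp add: p_def vec_def E_def e_def flip: of_real_diff)
  have NE: "(\<Sum>b\<in>B. \<Sum>b'\<in>B. (cmod (E b b'))\<^sup>2) \<ge> 0"
    by (intro sum_nonneg) simp
  have "e\<^sup>2 \<le> d\<^sup>2" "sqrt (\<Sum>b\<in>B. \<Sum>b'\<in>B. (cmod (E b b'))\<^sup>2) \<le> d"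
  proof -
    show "e\<^sup>2 \<le> d\<^sup>2"
      using X(2) split NE by simp
    have "(\<Sum>b\<in>B. \<Sum>b'\<in>B. (cmod (E b b'))\<^sup>2) \<le> d\<^sup>2"
      using X(2) split zero_le_power2[of e] by linarith
    then show "sqrt (\<Sum>b\<in>B. \<Sum>b'\<in>B. (cmod (E b b'))\<^sup>2) \<le> d"
      using d by (intro real_le_lsqrt) auto
  qed
  note bounds = this
  have e: "e \<le> d"
    using bounds(1) d power2_le_imp_le[of e d] by linarith
  have trX: "psd B (ptrace A X)"
    by (rule psd_ptrace[OF A(1) B X(1)])
  \<comment> \<open>Since \<open>E\<close> has norm at most \<open>d\<close>, the partial trace of
    \<open>X\<close> is at most \<open>1 + d\<close> times the identity, and division by
    \<open>1 + d\<close> restores dual feasibility.\<close>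
  have "psd B (\<lambda>b b'. of_real d * of_bool (b = b') - - E b b')"
  proof (rule psd_shift[OF B])
    show "- E b' b = cnj (- E b b')" if "b \<in> B" "b' \<in> B" for b b'
      using psd_hermitian[OF trX that] by (auto simp: E_def)
    show "sqrt (\<Sum>b\<in>B. \<Sum>b'\<in>B. (cmod (- E b b'))\<^sup>2) \<le> d"
      using bounds(2) by simp
  qed
  moreover define c where "c = 1 / (1 + d)"
  have c: "c > 0" "c * (1 + d) = 1"
    using d by (simp_all add: c_def)
  have "of_real c * (of_real d * of_bool (b = b') - - E b b')
      = of_bool (b = b') - ptrace A (\<lambda>p q. of_real c * X p q) b b'" for b b'
  proof -
    have "of_real c * (of_real d * of_bool (b = b') - - E b b')
        = of_real (c * (1 + d)) * of_bool (b = b') - of_real c * ptrace A X b b'"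
      by (simp add: E_def algebra_simps)
    then show ?thesis
      unfolding c by (simp add: ptrace_def sum_distrib_left)
  qed
  ultimately have "psd B (\<lambda>b b'. of_bool (b = b') - ptrace A (\<lambda>p q. of_real c * X p q) b b')"
    using psd_scale[of B "\<lambda>b b'. of_real d * of_bool (b = b') - - E b b'" c] c by simp
  then have "dual_feasible A B (\<lambda>p q. of_real c * X p q)"
    unfolding dual_feasible_def using psd_scale[OF X(1), of c] c by simp
  moreover have "\<alpha> - \<epsilon> \<le> Re (pairing (A \<times> B) R (\<lambda>p q. of_real c * X p q))"
  proof -
    have "(\<alpha> - \<epsilon>) * (1 + d) = \<alpha> - d - d * \<epsilon>"
      using d(2) by (simp add: algebra_simps)
    also have "\<dots> \<le> \<alpha> - e"
      using d e \<open>0 < \<epsilon>\<close> mult_nonneg_nonneg[of d \<epsilon>] by linarith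
    finally have "(\<alpha> - \<epsilon>) * (1 + d) \<le> Re (pairing (A \<times> B) R X)"
      by (simp add: e_def)
    then have "c * ((\<alpha> - \<epsilon>) * (1 + d)) \<le> c * Re (pairing (A \<times> B) R X)"
      using c by (intro mult_left_mono) auto
    moreover have "c * ((\<alpha> - \<epsilon>) * (1 + d)) = \<alpha> - \<epsilon>"
      using c(2) by (metis mult.left_commute mult.right_neutral)
    ultimately show ?thesis
      by (simp add: pairing_scale_right)
  qed
  ultimately show ?thesis
    unfolding \<alpha>_def by blast
qed

subsection \<open>Multiplicativity\<close>

definition swap_mid :: "('a \<times> 'c) \<times> ('b \<times> 'd) \<Rightarrow> ('a \<times> 'b) \<times> ('c \<times> 'd)" where
  "swap_mid = (\<lambda>((a, a'), (b, b')). ((a, b), (a', b')))"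

text \<open>The tensor product in the factor order \<open>A A' B B'\<close>, so that
  \<open>amplify\<close> and \<open>ptrace\<close> act with the joint first system
  \<open>A \<times> A'\<close>.\<close>

definition tensor_kernel :: "('a \<times> 'b \<Rightarrow> 'a \<times> 'b \<Rightarrow> complex) \<Rightarrow> ('c \<times> 'd \<Rightarrow> 'c \<times> 'd \<Rightarrow> complex)
    \<Rightarrow> ('a \<times> 'c) \<times> ('b \<times> 'd) \<Rightarrow> ('a \<times> 'c) \<times> ('b \<times> 'd) \<Rightarrow> complex" where
  "tensor_kernel R R' = (\<lambda>p q. (\<lambda>(i, j) (k, l). R i k * R' j l) (swap_mid p) (swap_mid q))"

lemma bij_betw_swap_mid: "bij_betw swap_mid ((A \<times> A') \<times> (B \<times> B')) ((A \<times> B) \<times> (A' \<times> B'))"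
  by (rule bij_betw_byWitness[where f' = swap_mid]) (auto simp: swap_mid_def)

lemma psd_tensor_kernel:
  assumes "finite A" "finite A'" "finite B" "finite B'" "psd (A \<times> B) R" "psd (A' \<times> B') R'"
  shows "psd ((A \<times> A') \<times> (B \<times> B')) (tensor_kernel R R')"
  unfolding tensor_kernel_def
  using assms by (intro psd_reindex[OF bij_betw_swap_mid, THEN iffD2] psd_tensor) auto

lemma ktrace_tensor: "ktrace (I \<times> J) (\<lambda>(i, j) (k, l). M i k * N j l) = ktrace I M * ktrace J N"
  by (simp add: ktrace_def sum_Times sum_product)

text \<open>Up to reordering, telescoping gives \<open>(id \<otimes> Y) \<otimes> (id \<otimes> Y')
  - R \<otimes> R' = (id \<otimes> Y - R) \<otimes> (id \<otimes> Y') + R \<otimes> (id \<otimes> Y'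
  - R')\<close>, a sum of products of positive kernels.\<close>

lemma feasible_tensor_kernel:
  assumes fin: "finite A" "finite A'" "finite B" "finite B'" and ne: "A \<noteq> {}" "A' \<noteq> {}"
    and psd: "psd (A \<times> B) R" "psd (A' \<times> B') R'"
    and feas: "feasible A B R Y" "feasible A' B' R' Y'"
  shows "feasible (A \<times> A') (B \<times> B') (tensor_kernel R R') (\<lambda>(i, j) (k, l). Y i k * Y' j l)"
proof -
  have amp: "psd (A' \<times> B') (amplify Y')"
    by (rule feasible_psd(1)[OF fin(2,4) ne(2) psd(2) feas(2)])
  have "psd ((A \<times> B) \<times> (A' \<times> B')) (\<lambda>p q.
      (\<lambda>(i, j) (k, l). (amplify Y i k - R i k) * amplify Y' j l) p q
      + (\<lambda>(i, j) (k, l). R i k * (amplify Y' j l - R' j l)) p q)"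
    using fin psd feas[unfolded feasible_def] amp by (intro psd_add psd_tensor) auto
  from psd_reindex[OF bij_betw_swap_mid, THEN iffD2, OF this] show ?thesis
    unfolding feasible_def
    by (rule psd_cong[THEN iffD1, rotated])
      (auto simp: amplify_def tensor_kernel_def swap_mid_def algebra_simps)
qed

text \<open>The partial trace factorizes, and telescoping the identity minus the product of the two
  partial traces gives \<open>(id - T) \<otimes> id + T \<otimes> (id - T')\<close>.\<close>

lemma dual_feasible_tensor_kernel:
  assumes fin: "finite A" "finite A'" "finite B" "finite B'"
    and feas: "dual_feasible A B X" "dual_feasible A' B' X'"
  shows "dual_feasible (A \<times> A') (B \<times> B') (tensor_kernel X X')"
proof -
  have X: "psd (A \<times> B) X" "psd B (\<lambda>b b'. of_bool (b = b') - ptrace A X b b')"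
    and X': "psd (A' \<times> B') X'" "psd B' (\<lambda>b b'. of_bool (b = b') - ptrace A' X' b b')"
    using feas by (auto simp: dual_feasible_def)
  have pt: "ptrace (A \<times> A') (tensor_kernel X X') p q = ptrace A X (fst p) (fst q) * ptrace A' X' (snd p) (snd q)"
    for p q
    by (cases p; cases q) (simp add: ptrace_def tensor_kernel_def swap_mid_def sum_Times sum_product)
  have "psd (B \<times> B') (\<lambda>p q.
      (\<lambda>(i, j) (k, l). (of_bool (i = k) - ptrace A X i k) * of_bool (j = l)) p q
      + (\<lambda>(i, j) (k, l). ptrace A X i k * (of_bool (j = l) - ptrace A' X' j l)) p q)"
    using fin X X' by (intro psd_add psd_tensor psd_one psd_ptrace) auto
  then have "psd (B \<times> B') (\<lambda>p q. of_bool (p = q) - ptrace (A \<times> A') (tensor_kernel X X') p q)"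
    by (rule psd_cong[THEN iffD1, rotated]) (auto simp: pt algebra_simps)
  then show ?thesis
    unfolding dual_feasible_def using psd_tensor_kernel[OF fin X(1) X'(1)] by blast
qed

text \<open>Hermitian symmetry makes the pairing its own conjugate. Real values are what allows real
  parts of dual values to be multiplied.\<close>

lemma pairing_psd_real:
  assumes "psd I M" "psd I X"
  shows "pairing I M X = of_real (Re (pairing I M X))"
proof -
  have "cnj (pairing I M X) = (\<Sum>i\<in>I. \<Sum>j\<in>I. M j i * X i j)"
    unfolding pairing_def cnj_sum
  proof (intro sum.cong refl)
    show "cnj (M i j * X j i) = M j i * X i j" if "i \<in> I" "j \<in> I" for i j
      by (simp add: psd_hermitian[OF assms(1) that] psd_hermitian[OF assms(2) that])
  qed
  also have "\<dots> = pairing I M X"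
    unfolding pairing_def by (rule sum.swap)
  finally show ?thesis
    by (metis Reals_cnj_iff of_real_Re)
qed

text \<open>Primal and dual points within \<open>t\<close> of the optimum are multiplied. Either way
  the error is at most \<open>t * (\<alpha> + \<alpha>' + 1)\<close>, and \<open>t\<close> tends to
  0.\<close>

lemma cost_tensor_kernel:
  assumes fin: "finite A" "finite A'" "finite B" "finite B'" and ne: "A \<noteq> {}" "A' \<noteq> {}"
    and psd: "psd (A \<times> B) R" "psd (A' \<times> B') R'"
  shows "cost (A \<times> A') (B \<times> B') (tensor_kernel R R') = cost A B R * cost A' B' R'"
proof -
  define \<alpha> \<alpha>' \<gamma> where "\<alpha> = cost A B R" and "\<alpha>' = cost A' B' R'"
    and "\<gamma> = cost (A \<times> A') (B \<times> B') (tensor_kernel R R')"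
  have nonneg: "\<alpha> \<ge> 0" "\<alpha>' \<ge> 0"
    unfolding \<alpha>_def \<alpha>'_def using cost_nonneg fin ne psd by metis+
  have fin': "finite (A \<times> A')" "finite (B \<times> B')" "A \<times> A' \<noteq> {}"
    using fin ne by auto
  have psd': "psd ((A \<times> A') \<times> (B \<times> B')) (tensor_kernel R R')"
    by (rule psd_tensor_kernel[OF fin psd])
  have quad: "t * \<alpha> + t * \<alpha>' + t * t \<le> t * (\<alpha> + \<alpha>' + 1)" if "0 < t" "t \<le> 1" for t :: real
  proof -
    have "t * t \<le> t * 1"
      using that by (intro mult_left_mono) auto
    then show ?thesis
      by (simp add: algebra_simps)
  qed
  have "\<gamma> - \<alpha> * \<alpha>' \<le> 0"
  proof (rule nonpos_of_quadratic_bound[of _ "\<alpha> + \<alpha>' + 1"])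
    fix t :: real assume t: "0 < t" "t \<le> 1"
    obtain Y where Y: "feasible A B R Y" "Re (ktrace B Y) < \<alpha> + t"
      using cost_less_feasible[OF fin(1,3) psd(1), of "\<alpha> + t"] t unfolding \<alpha>_def by auto
    obtain Y' where Y': "feasible A' B' R' Y'" "Re (ktrace B' Y') < \<alpha>' + t"
      using cost_less_feasible[OF fin(2,4) psd(2), of "\<alpha>' + t"] t unfolding \<alpha>'_def by auto
    have Ypsd: "psd B Y" "psd B' Y'"
      using feasible_psd(2)[OF fin(1,3) ne(1) psd(1) Y(1)] feasible_psd(2)[OF fin(2,4) ne(2) psd(2) Y'(1)]
      by auto
    have "\<gamma> \<le> Re (ktrace (B \<times> B') (\<lambda>(i, j) (k, l). Y i k * Y' j l))"
      unfolding \<gamma>_def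
      by (rule cost_le[OF fin' psd' feasible_tensor_kernel[OF fin ne psd Y(1) Y'(1)]])
    also have "\<dots> = Re (ktrace B Y) * Re (ktrace B' Y')"
    proof -
      have "Im (ktrace B Y) = 0"
        unfolding ktrace_def Im_sum
        by (intro sum.neutral ballI) (metis Im_complex_of_real Ypsd(1) fin(3) psd_diag(2))
      then show ?thesis
        by (simp add: ktrace_tensor)
    qed
    also have "\<dots> \<le> (\<alpha> + t) * (\<alpha>' + t)"
      using Y(2) Y'(2) ktrace_psd_nonneg[OF fin(4) Ypsd(2)] nonneg t by (intro mult_mono) auto
    also have "\<dots> \<le> \<alpha> * \<alpha>' + t * (\<alpha> + \<alpha>' + 1)"
      using quad[OF t] by (simp add: algebra_simps)
    \<comment> \<open>The factor \<open>t\<close> brings the estimate into the shape of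
      \<open>nonpos_of_quadratic_bound\<close>.\<close>
    finally have "t * (\<gamma> - \<alpha> * \<alpha>') \<le> t * (t * (\<alpha> + \<alpha>' + 1))"
      using t by (intro mult_left_mono) auto
    then show "t * (\<gamma> - \<alpha> * \<alpha>') \<le> t\<^sup>2 * (\<alpha> + \<alpha>' + 1)"
      by (simp add: power2_eq_square mult_ac)
  qed
  moreover have "\<alpha> * \<alpha>' - \<gamma> \<le> 0"
  proof (rule nonpos_of_quadratic_bound[of _ "\<alpha> + \<alpha>' + 1"])
    fix t :: real assume t: "0 < t" "t \<le> 1"
    obtain X where X: "dual_feasible A B X" "\<alpha> - t \<le> Re (pairing (A \<times> B) R X)"
      using strong_duality[OF fin(1) ne(1) fin(3) psd(1) t(1)] unfolding \<alpha>_def by blast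
    obtain X' where X': "dual_feasible A' B' X'" "\<alpha>' - t \<le> Re (pairing (A' \<times> B') R' X')"
      using strong_duality[OF fin(2) ne(2) fin(4) psd(2) t(1)] unfolding \<alpha>'_def by blast
    define p p' where "p = Re (pairing (A \<times> B) R X)" and "p' = Re (pairing (A' \<times> B') R' X')"
    have Xpsd: "psd (A \<times> B) X" "psd (A' \<times> B') X'"
      using X X' by (auto simp: dual_feasible_def)
    have p: "0 \<le> p" "p \<le> \<alpha>" "\<alpha> \<le> p + t"
      unfolding p_def \<alpha>_def
      using pairing_psd_nonneg[OF _ psd(1) Xpsd(1)] fin X(2) \<alpha>_def
        le_costI[OF fin(1,3) psd(1) weak_duality[OF fin(1,3) ne(1) psd(1) _ X(1)]] by auto
    have p': "0 \<le> p'" "p' \<le> \<alpha>'" "\<alpha>' \<le> p' + t"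
      unfolding p'_def \<alpha>'_def
      using pairing_psd_nonneg[OF _ psd(2) Xpsd(2)] fin X'(2) \<alpha>'_def
        le_costI[OF fin(2,4) psd(2) weak_duality[OF fin(2,4) ne(2) psd(2) _ X'(1)]] by auto
    have "pairing ((A \<times> A') \<times> (B \<times> B')) (tensor_kernel R R') (tensor_kernel X X')
        = pairing (A \<times> B) R X * pairing (A' \<times> B') R' X'"
      unfolding tensor_kernel_def pairing_reindex[OF bij_betw_swap_mid] by (rule pairing_tensor)
    also have "\<dots> = of_real (p * p')"
      using pairing_psd_real[OF psd(1) Xpsd(1)] pairing_psd_real[OF psd(2) Xpsd(2)]
      unfolding p_def p'_def by (metis of_real_mult)
    finally have "p * p' \<le> \<gamma>"
      unfolding \<gamma>_def
      using le_costI[OF fin'(1,2) psd'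
          weak_duality[OF fin' psd' _ dual_feasible_tensor_kernel[OF fin X(1) X'(1)]]] by simp
    \<comment> \<open>Working with \<open>p + t\<close> keeps all factors nonnegative, which
      \<open>\<alpha> - t\<close> might not be.\<close>
    moreover have "\<alpha> * \<alpha>' \<le> (p + t) * (p' + t)"
      using p p' nonneg t by (intro mult_mono) auto
    moreover have "t * p \<le> t * \<alpha>" "t * p' \<le> t * \<alpha>'"
      using t p p' by (auto intro: mult_left_mono)
    ultimately have "\<alpha> * \<alpha>' - \<gamma> \<le> t * (\<alpha> + \<alpha>' + 1)"
      using quad[OF t] by (simp add: algebra_simps)
    then have "t * (\<alpha> * \<alpha>' - \<gamma>) \<le> t * (t * (\<alpha> + \<alpha>' + 1))"
      using t by (intro mult_left_mono) auto
    then show "t * (\<alpha> * \<alpha>' - \<gamma>) \<le> t\<^sup>2 * (\<alpha> + \<alpha>' + 1)"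
      by (simp add: power2_eq_square mult_ac)
  qed
  ultimately show ?thesis
    by (simp add: \<alpha>_def \<alpha>'_def \<gamma>_def)
qed

section \<open>Invariance of the cost under relabelling\<close>

lemma feasible_cong:
  assumes "\<And>p q. p \<in> A \<times> B \<Longrightarrow> q \<in> A \<times> B \<Longrightarrow> R p q = R' p q"
    and "\<And>b b'. b \<in> B \<Longrightarrow> b' \<in> B \<Longrightarrow> Y b b' = Y' b b'"
  shows "feasible A B R Y \<longleftrightarrow> feasible A B R' Y'"
  unfolding feasible_def using assms by (intro psd_cong) (auto simp: amplify_def)

lemma cost_cong:
  assumes "\<And>p q. p \<in> A \<times> B \<Longrightarrow> q \<in> A \<times> B \<Longrightarrow> R p q = R' p q"
  shows "cost A B R = cost A B R'"
proof -
  have "feasible A B R = feasible A B R'"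
    using assms by (intro ext feasible_cong) auto
  then show ?thesis
    by (simp add: cost_def)
qed

text \<open>Injectivity of \<open>f\<close> preserves the Kronecker delta inside
  \<open>amplify\<close>.\<close>

lemma feasible_reindex:
  assumes "bij_betw f A' A" "bij_betw g B' B"
  shows "feasible A' B' (\<lambda>(a, b) (c, d). R (f a, g b) (f c, g d)) (\<lambda>b d. Y (g b) (g d))
    \<longleftrightarrow> feasible A B R Y"
proof -
  have bij: "bij_betw (map_prod f g) (A' \<times> B') (A \<times> B)"
    using assms by (rule bij_betw_map_prod)
  have "feasible A' B' (\<lambda>(a, b) (c, d). R (f a, g b) (f c, g d)) (\<lambda>b d. Y (g b) (g d))
      \<longleftrightarrow> psd (A' \<times> B') (\<lambda>p q. (\<lambda>p q. amplify Y p q - R p q) (map_prod f g p) (map_prod f g q))"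
    unfolding feasible_def using bij_betw_imp_inj_on[OF assms(1)]
    by (intro psd_cong) (auto simp: amplify_def inj_on_def)
  also have "\<dots> \<longleftrightarrow> feasible A B R Y"
    unfolding feasible_def by (rule psd_reindex[OF bij])
  finally show ?thesis .
qed

lemma cost_reindex:
  assumes "bij_betw f A' A" "bij_betw g B' B"
  shows "cost A' B' (\<lambda>(a, b) (c, d). R (f a, g b) (f c, g d)) = cost A B R"
proof -
  let ?R = "\<lambda>(a, b) (c, d). R (f a, g b) (f c, g d)"
  define h where "h = inv_into B' g"
  have h: "h (g b) = b" if "b \<in> B'" for b
    using assms(2) that by (simp add: h_def bij_betw_def)
  have tr: "ktrace B' (\<lambda>b d. Y (g b) (g d)) = ktrace B Y" for Y
    unfolding ktrace_def by (rule sum.reindex_bij_betw[OF assms(2), of "\<lambda>b. Y b b"])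
  have "(\<lambda>Y. Re (ktrace B' Y)) ` {Y. feasible A' B' ?R Y} = (\<lambda>Y. Re (ktrace B Y)) ` {Y. feasible A B R Y}"
  proof (intro equalityI subsetI)
    fix x assume "x \<in> (\<lambda>Y. Re (ktrace B' Y)) ` {Y. feasible A' B' ?R Y}"
    then obtain Y where Y: "feasible A' B' ?R Y" "x = Re (ktrace B' Y)"
      by blast
    define Z where "Z = (\<lambda>b d. Y (h b) (h d))"
    have "feasible A' B' ?R Y \<longleftrightarrow> feasible A' B' ?R (\<lambda>b d. Z (g b) (g d))"
      by (rule feasible_cong) (simp_all add: Z_def h)
    with Y(1) have "feasible A B R Z"
      using feasible_reindex[OF assms, of R Z] by blast
    moreover have "ktrace B' Y = ktrace B Z"
      unfolding tr[symmetric] by (simp add: ktrace_def Z_def h)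
    ultimately show "x \<in> (\<lambda>Y. Re (ktrace B Y)) ` {Y. feasible A B R Y}"
      using Y(2) by auto
  next
    fix x assume "x \<in> (\<lambda>Y. Re (ktrace B Y)) ` {Y. feasible A B R Y}"
    then obtain Y where Y: "feasible A B R Y" "x = Re (ktrace B Y)"
      by blast
    show "x \<in> (\<lambda>Y. Re (ktrace B' Y)) ` {Y. feasible A' B' ?R Y}"
      using Y feasible_reindex[OF assms, of R Y] tr[of Y] by (metis (mono_tags) imageI mem_Collect_eq)
  qed
  then show ?thesis
    unfolding cost_def by simp
qed

subsection \<open>Independence of the purification\<close>

lemma sum_product_rotate:
  fixes f :: "'i \<Rightarrow> 'c \<Rightarrow> complex"
  shows "(\<Sum>c\<in>C. (\<Sum>i\<in>I. f i c) * (\<Sum>j\<in>J. g j c)) = (\<Sum>i\<in>I. \<Sum>j\<in>J. \<Sum>c\<in>C. f i c * g j c)"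
  unfolding sum_product by (rule sum_rotate[symmetric])

text \<open>Both sides expand into the Gram kernel alone, so inner products of combinations of the
  \<open>L i\<close> carry over to the \<open>w i\<close>.\<close>

lemma gram_transfer:
  assumes "\<forall>i\<in>I. \<forall>j\<in>I. (\<Sum>c\<in>C. w i c * cnj (w j c)) = (\<Sum>m\<in>K. L i m * cnj (L j m))"
  shows "(\<Sum>c\<in>C. (\<Sum>i\<in>I. p i * w i c) * cnj (\<Sum>i\<in>I. q i * w i c))
    = (\<Sum>m\<in>K. (\<Sum>i\<in>I. p i * L i m) * cnj (\<Sum>i\<in>I. q i * L i m))"
proof -
  have gen: "(\<Sum>c\<in>C. (\<Sum>i\<in>I. p i * w i c) * cnj (\<Sum>i\<in>I. q i * w i c))
      = (\<Sum>i\<in>I. \<Sum>j\<in>I. p i * cnj (q j) * (\<Sum>c\<in>C. w i c * cnj (w j c)))" for C :: "'x set" and w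
    unfolding cnj_sum sum_product_rotate unfolding sum_distrib_left
    by (intro sum.cong refl) (simp add: mult_ac)
  show ?thesis
    unfolding gen using assms by (intro sum.cong refl) simp
qed

text \<open>Orthonormality is \<open>D L = id\<close> carried over by \<open>gram_transfer\<close>.
  The expansion holds because its residual is a combination of the \<open>w j\<close> whose
  counterpart for \<open>L\<close> vanishes, so its norm is 0.\<close>

lemma orthonormal_expansion:
  assumes fin: "finite I" "finite C" "finite K"
    and gram: "\<forall>i\<in>I. \<forall>j\<in>I. (\<Sum>c\<in>C. w i c * cnj (w j c)) = (\<Sum>m\<in>K. L i m * cnj (L j m))"
    and D: "\<forall>k\<in>K. \<forall>l\<in>K. (\<Sum>i\<in>I. D k i * L i l) = of_bool (k = l)"
    and e: "e = (\<lambda>k c. \<Sum>i\<in>I. D k i * w i c)"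
  shows "\<forall>k\<in>K. \<forall>l\<in>K. (\<Sum>c\<in>C. e k c * cnj (e l c)) = of_bool (k = l)"
    and "\<And>i c. i \<in> I \<Longrightarrow> c \<in> C \<Longrightarrow> w i c = (\<Sum>k\<in>K. L i k * e k c)"
proof -
  show "\<forall>k\<in>K. \<forall>l\<in>K. (\<Sum>c\<in>C. e k c * cnj (e l c)) = of_bool (k = l)"
  proof (intro ballI)
    fix k l assume kl: "k \<in> K" "l \<in> K"
    have "(\<Sum>c\<in>C. e k c * cnj (e l c)) = (\<Sum>m\<in>K. (\<Sum>i\<in>I. D k i * L i m) * cnj (\<Sum>i\<in>I. D l i * L i m))"
      unfolding e by (rule gram_transfer[OF gram])
    also have "\<dots> = (\<Sum>m\<in>K. if m = k then of_bool (k = l) else 0)"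
      by (intro sum.cong refl) (use D kl in auto)
    also have "\<dots> = of_bool (k = l)"
      using kl fin by simp
    finally show "(\<Sum>c\<in>C. e k c * cnj (e l c)) = of_bool (k = l)" .
  qed
  show "w i c = (\<Sum>k\<in>K. L i k * e k c)" if ic: "i \<in> I" "c \<in> C" for i c
  proof -
    \<comment> \<open>Coefficients of the residual: combining vectors \<open>v j\<close> with
      \<open>P\<close> gives \<open>v i\<close> minus its expansion through \<open>L\<close> and
      \<open>D\<close>.\<close>
    define P where "P = (\<lambda>j. of_bool (j = i) - (\<Sum>k\<in>K. L i k * D k j))"
    have Pgen: "(\<Sum>j\<in>I. P j * v j) = v i - (\<Sum>k\<in>K. L i k * (\<Sum>j\<in>I. D k j * v j))" for v
    proof -
      have "(\<Sum>j\<in>I. P j * v j) = (\<Sum>j\<in>I. if j = i then v j else 0) - (\<Sum>j\<in>I. \<Sum>k\<in>K. L i k * D k j * v j)"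
        unfolding sum_subtractf[symmetric]
        by (intro sum.cong refl) (simp add: P_def left_diff_distrib sum_distrib_right)
      also have "(\<Sum>j\<in>I. \<Sum>k\<in>K. L i k * D k j * v j) = (\<Sum>k\<in>K. L i k * (\<Sum>j\<in>I. D k j * v j))"
        unfolding sum_distrib_left by (subst sum.swap) (simp add: mult_ac)
      finally show ?thesis
        using ic fin by simp
    qed
    have PL: "(\<Sum>j\<in>I. P j * L j m) = 0" if m: "m \<in> K" for m
    proof -
      have "(\<Sum>k\<in>K. L i k * (\<Sum>j\<in>I. D k j * L j m)) = (\<Sum>k\<in>K. if k = m then L i k else 0)"
        using D m by (intro sum.cong refl) simp
      then show ?thesis
        unfolding Pgen using m fin by simp
    qed
    define x where "x = (\<lambda>c. \<Sum>j\<in>I. P j * w j c)"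
    have "(\<Sum>c\<in>C. x c * cnj (x c)) = (\<Sum>m\<in>K. (\<Sum>j\<in>I. P j * L j m) * cnj (\<Sum>j\<in>I. P j * L j m))"
      unfolding x_def by (rule gram_transfer[OF gram])
    also have "\<dots> = 0"
      using PL by simp
    finally have "complex_of_real (\<Sum>c\<in>C. (cmod (x c))\<^sup>2) = 0"
      by (simp only: of_real_sum complex_norm_square)
    then have "(\<Sum>c\<in>C. (cmod (x c))\<^sup>2) = 0"
      by (simp only: of_real_eq_0_iff)
    then have "x c = 0"
      using ic fin by (simp add: sum_nonneg_eq_0_iff)
    then show ?thesis
      unfolding x_def Pgen e by simp
  qed
qed

text \<open>\<open>Q\<close> is a Hermitian idempotent, so
  \<open>id - Q = (id - Q) (id - Q)\<^sup>*\<close> is a Gram kernel.\<close>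

lemma psd_one_minus_projection:
  assumes fin: "finite C" "finite K"
    and on: "\<forall>k\<in>K. \<forall>l\<in>K. (\<Sum>c\<in>C. e k c * cnj (e l c)) = of_bool (k = l)"
  shows "psd C (\<lambda>c d. of_bool (c = d) - (\<Sum>k\<in>K. e k c * cnj (e k d)))"
proof -
  define Q where "Q = (\<lambda>c d. \<Sum>k\<in>K. e k c * cnj (e k d))"
  have cnjQ: "cnj (Q c d) = Q d c" for c d
    by (simp add: Q_def mult.commute)
  have QQ: "(\<Sum>z\<in>C. Q c z * Q z d) = Q c d" for c d
  proof -
    have "(\<Sum>z\<in>C. Q c z * Q z d) = (\<Sum>k\<in>K. \<Sum>l\<in>K. e k c * cnj (e l d) * (\<Sum>z\<in>C. e l z * cnj (e k z)))"
      unfolding Q_def sum_product_rotate unfolding sum_distrib_left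
      by (intro sum.cong refl) (simp add: mult_ac)
    also have "\<dots> = (\<Sum>k\<in>K. \<Sum>l\<in>K. if l = k then e k c * cnj (e l d) else 0)"
      using on by (intro sum.cong refl) simp
    also have "\<dots> = Q c d"
      using fin by (simp add: Q_def)
    finally show ?thesis .
  qed
  have "psd C (\<lambda>c d. \<Sum>z\<in>C. (of_bool (c = z) - Q c z) * cnj (of_bool (d = z) - Q d z))"
    by (rule psd_gram)
  then have "psd C (\<lambda>c d. of_bool (c = d) - Q c d)"
  proof (rule psd_cong[THEN iffD1, rotated])
    fix c d assume cd: "c \<in> C" "d \<in> C"
    have "(\<Sum>z\<in>C. (of_bool (c = z) - Q c z) * cnj (of_bool (d = z) - Q d z))
        = (\<Sum>z\<in>C. if z = c then of_bool (d = z) - Q z d else 0) - (\<Sum>z\<in>C. if z = d then Q c z else 0)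
          + (\<Sum>z\<in>C. Q c z * Q z d)"
      unfolding sum_subtractf[symmetric] sum.distrib[symmetric]
      by (intro sum.cong refl) (auto simp: cnjQ algebra_simps)
    also have "\<dots> = of_bool (c = d) - Q c d"
      using cd fin by (auto simp: QQ)
    finally show "(\<Sum>z\<in>C. (of_bool (c = z) - Q c z) * cnj (of_bool (d = z) - Q d z)) = of_bool (c = d) - Q c d" .
  qed
  then show ?thesis
    unfolding Q_def .
qed

text \<open>The last condition says, up to transposition, that \<open>W W\<^sup>* \<le> id\<close>.\<close>

lemma partial_isometry:
  assumes fin: "finite I" "finite C" "finite C'"
    and gram: "\<forall>i\<in>I. \<forall>j\<in>I. (\<Sum>c\<in>C. w i c * cnj (w j c)) = (\<Sum>c\<in>C'. u i c * cnj (u j c))"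
  shows "\<exists>W. (\<forall>i\<in>I. \<forall>c'\<in>C'. u i c' = (\<Sum>c\<in>C. w i c * W c c'))
    \<and> psd C (\<lambda>c d. of_bool (c = d) - (\<Sum>c'\<in>C'. W d c' * cnj (W c c')))"
proof -
  have "psd I (\<lambda>i j. \<Sum>c\<in>C. w i c * cnj (w j c))"
    by (rule psd_gram)
  from cholesky[OF fin(1) this] obtain K L D where
    K: "K \<subseteq> I" and L: "\<forall>i\<in>I. \<forall>j\<in>I. (\<Sum>c\<in>C. w i c * cnj (w j c)) = (\<Sum>k\<in>K. L i k * cnj (L j k))"
    and D: "\<forall>k\<in>K. \<forall>l\<in>K. (\<Sum>i\<in>I. D k i * L i l) = of_bool (k = l)"
    by blast
  have finK: "finite K"
    using K fin finite_subset by blast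
  have L': "\<forall>i\<in>I. \<forall>j\<in>I. (\<Sum>c\<in>C'. u i c * cnj (u j c)) = (\<Sum>k\<in>K. L i k * cnj (L j k))"
    using gram L by simp
  define e where "e = (\<lambda>k c. \<Sum>i\<in>I. D k i * w i c)"
  define f where "f = (\<lambda>k c. \<Sum>i\<in>I. D k i * u i c)"
  note E = orthonormal_expansion[OF fin(1,2) finK L D e_def]
  note F = orthonormal_expansion[OF fin(1,3) finK L' D f_def]
  \<comment> \<open>\<open>W\<close> sends the orthonormal family \<open>e\<close> to the
    orthonormal family \<open>f\<close>, both obtained with the same \<open>D\<close>, and kills the
    complement of \<open>e\<close>.\<close>
  define W where "W = (\<lambda>c c'. \<Sum>k\<in>K. cnj (e k c) * f k c')"
  show ?thesis
  proof (intro exI[of _ W] conjI ballI)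
    fix i c' assume i: "i \<in> I" and c': "c' \<in> C'"
    have coeff: "(\<Sum>c\<in>C. w i c * cnj (e k c)) = L i k" if k: "k \<in> K" for k
    proof -
      have "(\<Sum>c\<in>C. w i c * cnj (e k c)) = (\<Sum>c\<in>C. \<Sum>l\<in>K. L i l * (e l c * cnj (e k c)))"
        using E(2)[OF i] by (intro sum.cong refl) (simp add: sum_distrib_left sum_distrib_right mult_ac)
      also have "\<dots> = (\<Sum>l\<in>K. L i l * (\<Sum>c\<in>C. e l c * cnj (e k c)))"
        unfolding sum_distrib_left by (rule sum.swap)
      also have "\<dots> = (\<Sum>l\<in>K. if l = k then L i l else 0)"
        using E(1) k by (intro sum.cong refl) simp
      finally show ?thesis
        using k finK by simp
    qed
    have "(\<Sum>c\<in>C. w i c * W c c') = (\<Sum>c\<in>C. \<Sum>k\<in>K. f k c' * (w i c * cnj (e k c)))"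
      unfolding W_def sum_distrib_left by (intro sum.cong refl) (simp add: mult_ac)
    also have "\<dots> = (\<Sum>k\<in>K. f k c' * (\<Sum>c\<in>C. w i c * cnj (e k c)))"
      unfolding sum_distrib_left by (rule sum.swap)
    also have "\<dots> = u i c'"
      using F(2)[OF i c'] coeff by (simp add: mult.commute)
    finally show "u i c' = (\<Sum>c\<in>C. w i c * W c c')" ..
  next
    have "(\<Sum>c'\<in>C'. W d c' * cnj (W c c')) = (\<Sum>k\<in>K. e k c * cnj (e k d))" for c d
    proof -
      have "(\<Sum>c'\<in>C'. W d c' * cnj (W c c'))
          = (\<Sum>k\<in>K. \<Sum>l\<in>K. cnj (e k d) * e l c * (\<Sum>c'\<in>C'. f k c' * cnj (f l c')))"
        unfolding W_def cnj_sum sum_product_rotate unfolding sum_distrib_left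
        by (intro sum.cong refl) (simp add: mult_ac)
      also have "\<dots> = (\<Sum>k\<in>K. \<Sum>l\<in>K. if k = l then cnj (e k d) * e l c else 0)"
        using F(1) by (intro sum.cong refl) simp
      finally show ?thesis
        using finK by (simp add: mult.commute)
    qed
    then show "psd C (\<lambda>c d. of_bool (c = d) - (\<Sum>c'\<in>C'. W d c' * cnj (W c c')))"
      using psd_one_minus_projection[OF fin(2) finK E(1)] by simp
  qed
qed

text \<open>Congruence by the identity on \<open>A\<close> and \<open>W\<close> on \<open>C\<close>
  maps Gram vectors of \<open>M\<close> to Gram vectors of the result.\<close>

lemma psd_conjugate:
  assumes "finite A" "finite C" "psd (A \<times> C) M"
  shows "psd (A \<times> C') (\<lambda>(a, c') (b, d'). \<Sum>c\<in>C. \<Sum>d\<in>C. W c c' * M (a, c) (b, d) * cnj (W d d'))"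
proof -
  have "finite (A \<times> C)"
    using assms by simp
  from gram_exists[OF this assms(3)] obtain K L where "K \<subseteq> A \<times> C" and
    L: "\<forall>p\<in>A \<times> C. \<forall>q\<in>A \<times> C. M p q = (\<Sum>k\<in>K. L p k * cnj (L q k))"
    by blast
  define V where "V = (\<lambda>p k. \<Sum>c\<in>C. W c (snd p) * L (fst p, c) k)"
  have "psd (A \<times> C') (\<lambda>p q. \<Sum>k\<in>K. V p k * cnj (V q k))"
    by (rule psd_gram)
  then show ?thesis
  proof (rule psd_cong[THEN iffD1, rotated])
    fix p q assume pq: "p \<in> A \<times> C'" "q \<in> A \<times> C'"
    obtain a c' b d' where [simp]: "p = (a, c')" "q = (b, d')"
      by (cases p; cases q)
    have "(\<Sum>k\<in>K. V p k * cnj (V q k))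
        = (\<Sum>c\<in>C. \<Sum>d\<in>C. \<Sum>k\<in>K. W c c' * L (a, c) k * cnj (W d d' * L (b, d) k))"
      unfolding V_def cnj_sum sum_product_rotate by simp
    also have "\<dots> = (\<Sum>c\<in>C. \<Sum>d\<in>C. W c c' * M (a, c) (b, d) * cnj (W d d'))"
      using pq L by (intro sum.cong refl) (simp add: sum_distrib_left sum_distrib_right mult_ac)
    finally show "(\<Sum>k\<in>K. V p k * cnj (V q k))
        = (\<lambda>(a, c') (b, d'). \<Sum>c\<in>C. \<Sum>d\<in>C. W c c' * M (a, c) (b, d) * cnj (W d d')) p q"
      by simp
  qed
qed

text \<open>The reduced state on \<open>A \<otimes> C\<close> of the pure state with amplitudes \<open>w (a, b) c\<close>.\<close>

definition reduced :: "'b set \<Rightarrow> ('a \<times> 'b \<Rightarrow> 'c \<Rightarrow> complex) \<Rightarrow> 'a \<times> 'c \<Rightarrow> 'a \<times> 'c \<Rightarrow> complex" where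
  "reduced B w = (\<lambda>(a, c) (a', c'). \<Sum>b\<in>B. w (a, b) c * cnj (w (a', b) c'))"

lemma psd_reduced: "psd I (reduced B w)"
proof -
  have eq: "reduced B w = (\<lambda>p q. \<Sum>b\<in>B. w (fst p, b) (snd p) * cnj (w (fst q, b) (snd q)))"
    by (auto simp: reduced_def fun_eq_iff)
  show ?thesis
    unfolding eq by (rule psd_gram[of I "\<lambda>p b. w (fst p, b) (snd p)"])
qed

text \<open>\<open>W\<close> turns the amplitudes \<open>w\<close> into \<open>u\<close>, and
  congruence by \<open>W\<close> maps a feasible \<open>Y\<close> to a feasible \<open>Y'\<close> of
  no larger trace.\<close>

lemma cost_reduced_le:
  assumes fin: "finite A" "finite B" "finite C" "finite C'" and ne: "A \<noteq> {}"
    and gram: "\<forall>i\<in>A \<times> B. \<forall>j\<in>A \<times> B.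
      (\<Sum>c\<in>C. w i c * cnj (w j c)) = (\<Sum>c\<in>C'. u i c * cnj (u j c))"
  shows "cost A C' (reduced B u) \<le> cost A C (reduced B w)"
proof -
  have finI: "finite (A \<times> B)"
    using fin by simp
  have "\<exists>W. (\<forall>i\<in>A \<times> B. \<forall>c'\<in>C'. u i c' = (\<Sum>c\<in>C. w i c * W c c'))
      \<and> psd C (\<lambda>c d. of_bool (c = d) - (\<Sum>c'\<in>C'. W d c' * cnj (W c c')))"
    by (rule partial_isometry[OF finI fin(3,4) gram])
  then obtain W where u: "\<forall>i\<in>A \<times> B. \<forall>c'\<in>C'. u i c' = (\<Sum>c\<in>C. w i c * W c c')"
    and W: "psd C (\<lambda>c d. of_bool (c = d) - (\<Sum>c'\<in>C'. W d c' * cnj (W c c')))"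
    by (elim exE conjE)
  show ?thesis
  proof (rule le_costI[OF fin(1,3) psd_reduced])
    fix Y assume Y: "feasible A C (reduced B w) Y"
    define Y' where "Y' = (\<lambda>c' d'. \<Sum>c\<in>C. \<Sum>d\<in>C. W c c' * Y c d * cnj (W d d'))"
    from Y have "psd (A \<times> C') (\<lambda>(a, c') (b, d'). \<Sum>c\<in>C. \<Sum>d\<in>C.
        W c c' * (amplify Y (a, c) (b, d) - reduced B w (a, c) (b, d)) * cnj (W d d'))"
      unfolding feasible_def by (rule psd_conjugate[OF fin(1,3)])
    then have "feasible A C' (reduced B u) Y'"
      unfolding feasible_def
    proof (rule psd_cong[THEN iffD1, rotated])
      fix p q assume pq: "p \<in> A \<times> C'" "q \<in> A \<times> C'"
      obtain a c' b d' where [simp]: "p = (a, c')" "q = (b, d')"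
        by (cases p; cases q)
      have "reduced B u p q = (\<Sum>x\<in>B. (\<Sum>c\<in>C. w (a, x) c * W c c') * cnj (\<Sum>d\<in>C. w (b, x) d * W d d'))"
        using pq by (simp add: reduced_def u)
      also have "\<dots> = (\<Sum>c\<in>C. \<Sum>d\<in>C. W c c' * reduced B w (a, c) (b, d) * cnj (W d d'))"
        unfolding cnj_sum sum_product_rotate
        by (intro sum.cong refl) (simp add: reduced_def sum_distrib_left sum_distrib_right mult_ac)
      finally have "amplify Y' p q - reduced B u p q
          = (\<Sum>c\<in>C. \<Sum>d\<in>C. W c c' * amplify Y (a, c) (b, d) * cnj (W d d'))
            - (\<Sum>c\<in>C. \<Sum>d\<in>C. W c c' * reduced B w (a, c) (b, d) * cnj (W d d'))"
        by (simp add: amplify_def Y'_def)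
      then show "(\<lambda>(a, c') (b, d'). \<Sum>c\<in>C. \<Sum>d\<in>C.
            W c c' * (amplify Y (a, c) (b, d) - reduced B w (a, c) (b, d)) * cnj (W d d')) p q
          = amplify Y' p q - reduced B u p q"
        by (simp add: sum_subtractf algebra_simps)
    qed
    then have "cost A C' (reduced B u) \<le> Re (ktrace C' Y')"
      by (rule cost_le[OF fin(1,4) ne psd_reduced])
    \<comment> \<open>Cyclicity of the trace moves both copies of \<open>W\<close> to the dual side,
      where their product is bounded by the identity.\<close>
    also have "ktrace C' Y' = pairing C Y (\<lambda>c d. \<Sum>c'\<in>C'. W d c' * cnj (W c c'))"
      unfolding ktrace_def Y'_def pairing_def sum_distrib_left
      by (subst sum_rotate[symmetric], intro sum.cong refl) (simp add: mult_ac)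
    also have "Re \<dots> \<le> Re (ktrace C Y)"
      using pairing_psd_nonneg[OF fin(3) feasible_psd(2)[OF fin(1,3) ne psd_reduced Y] W]
      unfolding pairing_diff_right pairing_one[OF fin(3)] by simp
    finally show "cost A C' (reduced B u) \<le> Re (ktrace C Y)" .
  qed
qed

subsection \<open>From matrices to kernels\<close>

definition pair_index :: "nat \<Rightarrow> nat \<times> nat \<Rightarrow> nat" where
  "pair_index e = (\<lambda>(i, j). i * e + j)"

lemma pair_index_less:
  assumes "i < d" "j < e"
  shows "pair_index e (i, j) < d * e"
proof -
  have "i * e + j < Suc i * e"
    using assms by simp
  also have "\<dots> \<le> d * e"
    using assms by (intro mult_right_mono) auto
  finally show ?thesis
    by (simp add: pair_index_def)
qed

lemma pair_index_div_mod: "j < e \<Longrightarrow> pair_index e (i, j) div e = i" "j < e \<Longrightarrow> pair_index e (i, j) mod e = j"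
  by (auto simp: pair_index_def)

lemma pair_index_decode: "pair_index e (k div e, k mod e) = k"
  by (simp add: pair_index_def)

lemma div_mod_less:
  assumes "k < d * e"
  shows "k div e < d" "k mod e < (e :: nat)"
  using assms by (auto simp: less_mult_imp_div_less) (metis gr0I mod_less_divisor mult_0_right not_less_zero)

lemma bij_betw_pair_index: "bij_betw (pair_index e) ({..<d} \<times> {..<e}) {..<d * e}"
  by (rule bij_betw_byWitness[where f' = "\<lambda>k. (k div e, k mod e)"])
    (auto simp: pair_index_div_mod pair_index_decode pair_index_less div_mod_less)

lemma sum_pair_index: "(\<Sum>k<d * e. f k) = (\<Sum>i<d. \<Sum>j<e. f (pair_index e (i, j)))"
  using sum.reindex_bij_betw[OF bij_betw_pair_index[of e d], of f] by (simp add: sum_Times)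

definition kernel :: "nat \<Rightarrow> complex mat \<Rightarrow> nat \<times> nat \<Rightarrow> nat \<times> nat \<Rightarrow> complex" where
  "kernel e M = (\<lambda>p q. M $$ (pair_index e p, pair_index e q))"

lemma mat_adjoint_index:
  assumes "M \<in> carrier_mat n n" "i < n" "j < n"
  shows "mat_adjoint M $$ (i, j) = cnj (M $$ (j, i))"
  using assms by (simp add: mat_adjoint_def mat_of_rows_def conjugate_complex_def)

lemma nonneg_op_iff_psd:
  "nonneg_op n M \<longleftrightarrow> M \<in> carrier_mat n n \<and> psd {..<n} (\<lambda>i j. M $$ (i, j))"
proof (cases "M \<in> carrier_mat n n")
  case True
  have adj: "mat_adjoint M = M \<longleftrightarrow> (\<forall>i\<in>{..<n}. \<forall>j\<in>{..<n}. M $$ (j, i) = cnj (M $$ (i, j)))"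
  proof
    assume *: "mat_adjoint M = M"
    show "\<forall>i\<in>{..<n}. \<forall>j\<in>{..<n}. M $$ (j, i) = cnj (M $$ (i, j))"
    proof (intro ballI)
      fix i j assume "i \<in> {..<n}" "j \<in> {..<n}"
      then have "mat_adjoint M $$ (j, i) = cnj (M $$ (i, j))"
        using True by (intro mat_adjoint_index) auto
      then show "M $$ (j, i) = cnj (M $$ (i, j))"
        unfolding * .
    qed
  next
    assume *: "\<forall>i\<in>{..<n}. \<forall>j\<in>{..<n}. M $$ (j, i) = cnj (M $$ (i, j))"
    show "mat_adjoint M = M"
    proof (rule eq_matI)
      fix i j assume "i < dim_row M" "j < dim_col M"
      then have ij: "i < n" "j < n"
        using True by auto
      have "mat_adjoint M $$ (i, j) = cnj (M $$ (j, i))"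
        by (rule mat_adjoint_index[OF True ij])
      also have "\<dots> = M $$ (i, j)"
        using *[rule_format, of j i] ij by simp
      finally show "mat_adjoint M $$ (i, j) = M $$ (i, j)" .
    qed (use True in \<open>auto simp: mat_adjoint_def\<close>)
  qed
  have form: "(M *\<^sub>v v) \<bullet>c v = qform {..<n} (\<lambda>i j. M $$ (i, j)) (\<lambda>i. v $ i)" if "v \<in> carrier_vec n" for v
  proof -
    have "(M *\<^sub>v v) \<bullet>c v = (\<Sum>i<n. (\<Sum>j<n. M $$ (i, j) * v $ j) * cnj (v $ i))"
      using True that by (auto simp: scalar_prod_def atLeast0LessThan conjugate_complex_def intro!: sum.cong)
    then show ?thesis
      by (simp add: qform_def sum_distrib_left sum_distrib_right mult_ac)
  qed
  have "(\<forall>v\<in>carrier_vec n. 0 \<le> Re ((M *\<^sub>v v) \<bullet>c v))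
      \<longleftrightarrow> (\<forall>x. 0 \<le> Re (qform {..<n} (\<lambda>i j. M $$ (i, j)) x))"
  proof (intro iffI allI ballI)
    fix x assume *: "\<forall>v\<in>carrier_vec n. 0 \<le> Re ((M *\<^sub>v v) \<bullet>c v)"
    \<comment> \<open>A test function is arbitrary outside \<open>{..<n}\<close>;
      \<open>vec n x\<close> keeps exactly the values that the form reads.\<close>
    have "qform {..<n} (\<lambda>i j. M $$ (i, j)) x = qform {..<n} (\<lambda>i j. M $$ (i, j)) (\<lambda>i. vec n x $ i)"
      by (intro qform_cong) auto
    then show "0 \<le> Re (qform {..<n} (\<lambda>i j. M $$ (i, j)) x)"
      using * form[of "vec n x"] by (metis vec_carrier)
  qed (use form in auto)
  then show ?thesis
    unfolding nonneg_op_def psd_def adj using True by simp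
qed (simp add: nonneg_op_def)

lemma mat_trace_ktrace: "M \<in> carrier_mat n n \<Longrightarrow> mat_trace M = ktrace {..<n} (\<lambda>i j. M $$ (i, j))"
  by (auto simp: mat_trace_def ktrace_def)

lemma nonneg_op_iff_kernel:
  "nonneg_op (d * e) M \<longleftrightarrow> M \<in> carrier_mat (d * e) (d * e) \<and> psd ({..<d} \<times> {..<e}) (kernel e M)"
  using psd_reindex[OF bij_betw_pair_index[of e d], of "\<lambda>i j. M $$ (i, j)"]
  unfolding nonneg_op_iff_psd kernel_def by simp

lemma density_op_iff_kernel:
  "density_op (d * e) M \<longleftrightarrow> M \<in> carrier_mat (d * e) (d * e)
    \<and> psd ({..<d} \<times> {..<e}) (kernel e M) \<and> ktrace ({..<d} \<times> {..<e}) (kernel e M) = 1"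
proof -
  have "ktrace ({..<d} \<times> {..<e}) (kernel e M) = mat_trace M" if "M \<in> carrier_mat (d * e) (d * e)"
    using ktrace_reindex[OF bij_betw_pair_index[of e d], of "\<lambda>i j. M $$ (i, j)"]
    unfolding kernel_def mat_trace_ktrace[OF that] .
  then show ?thesis
    unfolding density_op_def nonneg_op_iff_kernel by auto
qed

lemma tensor_mat_index:
  assumes "M \<in> carrier_mat d d" "N \<in> carrier_mat e e" "i < d" "j < e" "k < d" "l < e"
  shows "tensor_mat M N $$ (pair_index e (i, j), pair_index e (k, l)) = M $$ (i, k) * N $$ (j, l)"
  using assms pair_index_less[of i d j e] pair_index_less[of k d l e]
  by (simp add: tensor_mat_def pair_index_div_mod)

text \<open>The bridge from the operator order in \<open>D_infty\<close> to the program: the scalar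
  is absorbed into \<open>Y\<close>.\<close>

lemma op_le_iff_feasible:
  assumes "\<rho> \<in> carrier_mat (dA * dB) (dA * dB)" "\<sigma> \<in> carrier_mat dB dB"
  shows "op_le (dA * dB) \<rho> (c \<cdot>\<^sub>m tensor_mat (1\<^sub>m dA) \<sigma>)
    \<longleftrightarrow> feasible {..<dA} {..<dB} (kernel dB \<rho>) (\<lambda>i j. c * \<sigma> $$ (i, j))"
proof -
  have T: "tensor_mat (1\<^sub>m dA) \<sigma> \<in> carrier_mat (dA * dB) (dA * dB)"
    using assms by (auto simp: tensor_mat_def)
  have "kernel dB (c \<cdot>\<^sub>m tensor_mat (1\<^sub>m dA) \<sigma> - \<rho>) p q
      = amplify (\<lambda>i j. c * \<sigma> $$ (i, j)) p q - kernel dB \<rho> p q"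
    if pq: "p \<in> {..<dA} \<times> {..<dB}" "q \<in> {..<dA} \<times> {..<dB}" for p q
  proof -
    obtain a b a' b' where [simp]: "p = (a, b)" "q = (a', b')"
      by (cases p; cases q)
    have less: "a < dA" "b < dB" "a' < dA" "b' < dB"
      using pq by auto
    have "(c \<cdot>\<^sub>m tensor_mat (1\<^sub>m dA) \<sigma> - \<rho>) $$ (pair_index dB p, pair_index dB q)
        = c * tensor_mat (1\<^sub>m dA) \<sigma> $$ (pair_index dB p, pair_index dB q) - \<rho> $$ (pair_index dB p, pair_index dB q)"
      using T assms pair_index_less less by simp
    then show ?thesis
      using tensor_mat_index[OF one_carrier_mat assms(2) less] less
      by (simp add: kernel_def amplify_def)
  qed
  then have "psd ({..<dA} \<times> {..<dB}) (kernel dB (c \<cdot>\<^sub>m tensor_mat (1\<^sub>m dA) \<sigma> - \<rho>))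
      \<longleftrightarrow> feasible {..<dA} {..<dB} (kernel dB \<rho>) (\<lambda>i j. c * \<sigma> $$ (i, j))"
    unfolding feasible_def by (rule psd_cong)
  then show ?thesis
    using T assms unfolding op_le_def nonneg_op_iff_kernel by auto
qed

text \<open>Trace 1 forces \<open>card A * cost A B R\<close> to be at least 1. Positivity is what
  the logarithm laws ask for later.\<close>

lemma cost_pos:
  assumes "finite A" "finite B" "psd (A \<times> B) R" "ktrace (A \<times> B) R = 1"
  shows "0 < cost A B R"
proof -
  have A: "A \<noteq> {}"
    using assms(4) by (auto simp: ktrace_def)
  have "1 \<le> card A * cost A B R"
    using ktrace_le_cost[OF assms(1,2) A assms(3)] assms(4) by simp
  then show ?thesis
    using mult_nonneg_nonpos[of "real (card A)" "cost A B R"] by fastforce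
qed

text \<open>A feasible \<open>Y\<close> gives the state \<open>Y / tr Y\<close> with exponent
  \<open>log 2 (tr Y)\<close>; conversely \<open>2 powr l\<close> times a state has trace
  \<open>2 powr l\<close>. The double infimum thus becomes that of
  \<open>log 2 (tr Y)\<close>.\<close>

lemma H_min_eq_cost:
  assumes "density_op (dA * dB) \<rho>"
  shows "H_min dA dB \<rho> = ereal (- log 2 (cost {..<dA} {..<dB} (kernel dB \<rho>)))"
proof -
  let ?A = "{..<dA}" and ?B = "{..<dB}" and ?R = "kernel dB \<rho>"
  define \<alpha> where "\<alpha> = cost ?A ?B ?R"
  define I where "I = (INF \<sigma>\<in>Collect (density_op dB). D_infty (dA * dB) \<rho> (tensor_mat (1\<^sub>m dA) \<sigma>))"
  have \<rho>: "\<rho> \<in> carrier_mat (dA * dB) (dA * dB)" "psd (?A \<times> ?B) ?R" "ktrace (?A \<times> ?B) ?R = 1"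
    using assms unfolding density_op_iff_kernel by auto
  have A: "?A \<noteq> {}"
    using \<rho>(3) by (auto simp: ktrace_def)
  have \<alpha>: "\<alpha> > 0"
    unfolding \<alpha>_def using \<rho> by (intro cost_pos) auto
  have "I \<le> ereal (log 2 \<alpha>)"
  proof (rule ccontr)
    assume "\<not> ?thesis"
    \<comment> \<open>A real number strictly in between also covers an infinite
      \<open>I\<close>.\<close>
    then obtain z where z: "log 2 \<alpha> < z" "ereal z < I"
      using ereal_dense2[of "ereal (log 2 \<alpha>)" I] by (auto simp: not_le)
    have "\<alpha> < 2 powr z"
      using z(1) \<alpha> by (simp add: log_less_iff)
    then obtain Y where Y: "feasible ?A ?B ?R Y" "Re (ktrace ?B Y) < 2 powr z"
      using cost_less_feasible[OF _ _ \<rho>(2), of "2 powr z"] unfolding \<alpha>_def by auto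
    define t where "t = Re (ktrace ?B Y)"
    \<comment> \<open>Positivity comes from \<open>\<alpha> \<le> t\<close> and permits normalizing
      \<open>Y\<close>.\<close>
    have t: "0 < t" "t < 2 powr z"
      using \<alpha> cost_le[OF _ _ A \<rho>(2) Y(1)] Y(2) by (auto simp: t_def \<alpha>_def)
    have Ypsd: "psd ?B Y"
      using feasible_psd(2)[OF _ _ A \<rho>(2) Y(1)] by simp
    have trY: "ktrace ?B Y = of_real t"
      unfolding t_def ktrace_def Re_sum of_real_sum by (intro sum.cong refl psd_diag(2)[OF Ypsd]) auto
    define \<sigma> where "\<sigma> = mat dB dB (\<lambda>(i, j). of_real (1 / t) * Y i j)"
    have \<sigma>: "\<sigma> \<in> carrier_mat dB dB"
      by (simp add: \<sigma>_def)
    have "psd ?B (\<lambda>i j. \<sigma> $$ (i, j))"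
      using psd_scale[OF Ypsd, of "1 / t"] t
      by (subst psd_cong[of _ _ "\<lambda>i j. of_real (1 / t) * Y i j"]) (auto simp: \<sigma>_def)
    moreover have "mat_trace \<sigma> = of_real (1 / t) * ktrace ?B Y"
      unfolding mat_trace_ktrace[OF \<sigma>] ktrace_scale[symmetric] by (simp add: ktrace_def \<sigma>_def)
    ultimately have "density_op dB \<sigma>"
      using \<sigma> t by (simp add: density_op_def nonneg_op_iff_psd trY)
    moreover have "op_le (dA * dB) \<rho> (of_real (2 powr log 2 t) \<cdot>\<^sub>m tensor_mat (1\<^sub>m dA) \<sigma>)"
      unfolding op_le_iff_feasible[OF \<rho>(1) \<sigma>]
      using Y(1) t by (subst feasible_cong[of _ _ _ ?R _ Y]) (auto simp: \<sigma>_def)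
    ultimately have "I \<le> ereal (log 2 t)"
      unfolding I_def D_infty_def by (intro INF_lower2[of \<sigma>] Inf_lower) auto
    also have "log 2 t < z"
      using t by (simp add: log_less_iff)
    finally show False
      using z(2) by simp
  qed
  moreover have "ereal (log 2 \<alpha>) \<le> I"
    unfolding I_def D_infty_def
  proof (intro INF_greatest Inf_greatest)
    fix \<sigma> x assume "\<sigma> \<in> Collect (density_op dB)"
      and "x \<in> {ereal l |l. op_le (dA * dB) \<rho> (of_real (2 powr l) \<cdot>\<^sub>m tensor_mat (1\<^sub>m dA) \<sigma>)}"
    then obtain l where \<sigma>: "density_op dB \<sigma>" and x: "x = ereal l"
      and le: "op_le (dA * dB) \<rho> (of_real (2 powr l) \<cdot>\<^sub>m tensor_mat (1\<^sub>m dA) \<sigma>)"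
      by auto
    have c\<sigma>: "\<sigma> \<in> carrier_mat dB dB"
      using \<sigma> by (simp add: density_op_def nonneg_op_def)
    have "\<alpha> \<le> Re (ktrace ?B (\<lambda>i j. of_real (2 powr l) * \<sigma> $$ (i, j)))"
      using le unfolding op_le_iff_feasible[OF \<rho>(1) c\<sigma>] \<alpha>_def by (intro cost_le \<rho>(2) A) auto
    also have "\<dots> = 2 powr l"
      using \<sigma> unfolding ktrace_scale mat_trace_ktrace[OF c\<sigma>, symmetric] by (simp add: density_op_def)
    finally show "ereal (log 2 \<alpha>) \<le> x"
      using \<alpha> by (simp add: x log_le_iff)
  qed
  ultimately have "I = ereal (log 2 \<alpha>)"
    by (rule antisym)
  then show ?thesis
    unfolding H_min_def I_def \<alpha>_def by simp
qed

section \<open>Rank-one density operators as outer products\<close>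

lemma rank_outer_product:
  assumes M: "M \<in> carrier_mat n n" and out: "\<forall>i<n. \<forall>j<n. M $$ (i, j) = v i * cnj (v j)"
    and nz: "j < n" "M $$ (j, j) \<noteq> (0 :: complex)"
  shows "vec_space.rank n M = 1"
proof -
  interpret vec_space "TYPE(complex)" n .
  have "rank M \<le> 1"
    by (rule rank_le_1_product_entries[OF M, of v "\<lambda>j. cnj (v j)"]) (use M out in auto)
  \<comment> \<open>The nonzero diagonal entry makes column \<open>j\<close> nonzero, which bounds
    the rank below by 1.\<close>
  moreover have "lin_indpt {col M j}"
  proof
    assume "lin_dep {col M j}"
    moreover define A where "A = mat_of_cols n [col M j]"
    have c: "col M j \<in> carrier_vec n"
      using M nz by auto
    have cols: "cols A = [col M j]"
      unfolding A_def using c by (intro cols_mat_of_cols) auto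
    have A: "A \<in> carrier_mat n 1"
      by (simp add: A_def mat_of_cols_def)
    ultimately obtain x where x: "x \<in> carrier_vec 1" "x \<noteq> 0\<^sub>v 1" "A *\<^sub>v x = 0\<^sub>v n"
      using lin_depE[OF A] by (auto simp: cols)
    have "(A *\<^sub>v x) $ j = M $$ (j, j) * x $ 0"
      using x(1) nz(1) M by (simp add: A_def scalar_prod_def mat_of_cols_def)
    then have "x $ 0 = 0"
      using x(3) nz by simp
    then show False
      using x(1,2) by auto
  qed
  then have "card {col M j} \<le> rank M"
    using M nz by (intro rank_ge_card_indpt[OF M]) (auto simp: cols_def)
  ultimately show ?thesis
    by simp
qed

text \<open>Two independent columns would push the rank to 2; eliminating the coefficients of a
  dependence gives a vanishing 2x2 minor. Equal columns are treated apart because they collapse to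
  one element in a set of columns.\<close>

lemma rank_one_columns:
  assumes M: "M \<in> carrier_mat n n" and rank: "vec_space.rank n M = 1"
    and nz: "j < n" "M $$ (j, j) \<noteq> (0 :: complex)" and ik: "i < n" "k < n"
  shows "M $$ (i, k) * M $$ (j, j) = M $$ (i, j) * M $$ (j, k)"
proof (cases "col M j = col M k")
  case True
  have "M $$ (i, k) = M $$ (i, j)" "M $$ (j, k) = M $$ (j, j)"
    using arg_cong[OF True, of "\<lambda>v. v $ i"] arg_cong[OF True, of "\<lambda>v. v $ j"] M nz ik by auto
  then show ?thesis
    by simp
next
  case False
  interpret vec_space "TYPE(complex)" n .
  have "lin_dep {col M j, col M k}"
  proof (rule ccontr)
    assume "lin_indpt {col M j, col M k}"
    then have "card {col M j, col M k} \<le> rank M"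
      using M nz ik by (intro rank_ge_card_indpt[OF M]) (auto simp: cols_def)
    then show False
      using False rank by simp
  qed
  moreover define A where "A = mat_of_cols n [col M j, col M k]"
  have c: "col M j \<in> carrier_vec n" "col M k \<in> carrier_vec n"
    using M nz ik by auto
  have cols: "cols A = [col M j, col M k]"
    unfolding A_def using c by (intro cols_mat_of_cols) auto
  have A: "A \<in> carrier_mat n 2"
    by (simp add: A_def mat_of_cols_def numeral_2_eq_2)
  ultimately obtain x where x: "x \<in> carrier_vec 2" "x \<noteq> 0\<^sub>v 2" "A *\<^sub>v x = 0\<^sub>v n"
    using lin_depE[OF A] False by (auto simp: cols)
  have "(A *\<^sub>v x) $ l = M $$ (l, j) * x $ 0 + M $$ (l, k) * x $ 1" if "l < n" for l
    using x(1) that M nz ik by (simp add: A_def scalar_prod_def mat_of_cols_def numeral_2_eq_2)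
  then have rel: "M $$ (l, j) * x $ 0 + M $$ (l, k) * x $ 1 = 0" if "l < n" for l
    using x(3) that by simp
  \<comment> \<open>Otherwise row \<open>j\<close> would make the relation trivial; the factor
    \<open>x $ 1\<close> can therefore be cancelled.\<close>
  have "x $ 1 \<noteq> 0"
  proof
    assume x1: "x $ 1 = 0"
    then have "x $ 0 = 0"
      using rel[OF nz(1)] nz(2) by simp
    then have "x = 0\<^sub>v 2"
      using x(1) x1 by (intro eq_vecI) (auto simp: less_2_cases_iff)
    then show False
      using x(2) by simp
  qed
  moreover have "(M $$ (i, k) * M $$ (j, j)) * x $ 1 = (M $$ (i, j) * M $$ (j, k)) * x $ 1"
  proof -
    have eq: "M $$ (i, k) * x $ 1 = - (M $$ (i, j) * x $ 0)" "M $$ (j, k) * x $ 1 = - (M $$ (j, j) * x $ 0)"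
      using rel[OF ik(1)] rel[OF nz(1)] by (simp_all add: eq_neg_iff_add_eq_0 add.commute)
    have "(M $$ (i, k) * M $$ (j, j)) * x $ 1 = (M $$ (i, k) * x $ 1) * M $$ (j, j)"
      by (simp only: mult_ac)
    also have "\<dots> = M $$ (i, j) * - (M $$ (j, j) * x $ 0)"
      unfolding eq(1) by (simp only: mult_minus_left mult_minus_right mult_ac)
    also have "\<dots> = (M $$ (i, j) * M $$ (j, k)) * x $ 1"
      unfolding eq(2)[symmetric] by (simp only: mult_ac)
    finally show ?thesis .
  qed
  ultimately show ?thesis
    by simp
qed

text \<open>Trace 1 supplies a nonzero diagonal entry, and its column divided by the square root of
  that entry is the state vector.\<close>

lemma density_rank_one_outer:
  assumes "density_op n M" "vec_space.rank n M = 1"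
  shows "\<exists>v. \<forall>i<n. \<forall>k<n. M $$ (i, k) = v i * cnj (v k)"
proof -
  have M: "M \<in> carrier_mat n n" and psd: "psd {..<n} (\<lambda>i j. M $$ (i, j))" and tr: "mat_trace M = 1"
    using assms(1) by (auto simp: density_op_def nonneg_op_iff_psd)
  have "\<exists>j<n. M $$ (j, j) \<noteq> 0"
  proof (rule ccontr)
    assume "\<not> ?thesis"
    then have "mat_trace M = 0"
      using M by (auto simp: mat_trace_def intro!: sum.neutral)
    then show False
      using tr by simp
  qed
  then obtain j where j: "j < n" "M $$ (j, j) \<noteq> 0"
    by blast
  define r where "r = Re (M $$ (j, j))"
  have r: "r \<ge> 0" "M $$ (j, j) = of_real r"
    using psd_diag[OF psd, of j] j by (auto simp: r_def)
  define s where "s = complex_of_real (sqrt r)"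
  have s: "s * s = M $$ (j, j)" "cnj s = s" "s \<noteq> 0"
    using r j(2) by (auto simp: s_def simp flip: of_real_mult)
  have "M $$ (i, k) = (M $$ (i, j) / s) * cnj (M $$ (k, j) / s)" if ik: "i < n" "k < n" for i k
  proof -
    have "cnj (M $$ (k, j)) = M $$ (j, k)"
      using psd_hermitian[OF psd, of k j] ik j by simp
    then have "(M $$ (i, j) / s) * cnj (M $$ (k, j) / s) = M $$ (i, j) * M $$ (j, k) / (s * s)"
      using s(2) by simp
    also have "\<dots> = M $$ (i, k)"
      unfolding s(1) using rank_one_columns[OF M assms(2) j ik] j(2) by (simp add: field_simps)
    finally show ?thesis ..
  qed
  then show ?thesis
    by (intro exI[of _ "\<lambda>i. M $$ (i, j) / s"]) simp
qed

subsection \<open>Purifications and the max-entropy\<close>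

definition bipartite :: "nat \<Rightarrow> (nat \<Rightarrow> 'c \<Rightarrow> complex) \<Rightarrow> nat \<times> nat \<Rightarrow> 'c \<Rightarrow> complex" where
  "bipartite e w = (\<lambda>p. w (pair_index e p))"

text \<open>\<open>w i c\<close> are the amplitudes of a purification, seen as a rectangular matrix
  with \<open>\<rho> = w w\<^sup>*\<close>.\<close>

definition gram_rep :: "nat \<Rightarrow> nat \<Rightarrow> complex mat \<Rightarrow> (nat \<Rightarrow> nat \<Rightarrow> complex) \<Rightarrow> bool" where
  "gram_rep n dC \<rho> w \<longleftrightarrow> (\<forall>i<n. \<forall>j<n. \<rho> $$ (i, j) = (\<Sum>c<dC. w i c * cnj (w j c)))"

lemma gram_rep_exists:
  assumes "density_op n \<rho>"
  shows "\<exists>dC w. gram_rep n dC \<rho> w"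
proof -
  have psd: "psd {..<n} (\<lambda>i j. \<rho> $$ (i, j))"
    using assms by (simp add: density_op_def nonneg_op_iff_psd)
  from gram_exists[OF finite_lessThan this] obtain K L where K: "K \<subseteq> {..<n}" and
    L: "\<forall>i\<in>{..<n}. \<forall>j\<in>{..<n}. \<rho> $$ (i, j) = (\<Sum>k\<in>K. L i k * cnj (L j k))"
    by blast
  \<comment> \<open>Padding with zeros outside \<open>K\<close> lets the purifying dimension be
    \<open>n\<close>.\<close>
  define w where "w = (\<lambda>i k. if k \<in> K then L i k else 0)"
  have "(\<Sum>k<n. w i k * cnj (w j k)) = (\<Sum>k\<in>K. L i k * cnj (L j k))" for i j
    by (rule sum.mono_neutral_cong_right) (use K in \<open>auto simp: w_def\<close>)
  then show ?thesis
    using L by (intro exI[of _ n] exI[of _ w]) (simp add: gram_rep_def)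
qed

lemma is_purification_outer:
  assumes \<rho>: "density_op n \<rho>" and w: "gram_rep n dC \<rho> w"
  defines "\<psi> \<equiv> mat (n * dC) (n * dC) (\<lambda>(p, q). w (p div dC) (p mod dC) * cnj (w (q div dC) (q mod dC)))"
  shows "is_purification n dC \<rho> \<psi>"
proof -
  let ?N = "n * dC"
  define v where "v = (\<lambda>p. w (p div dC) (p mod dC))"
  have \<rho>n: "\<rho> \<in> carrier_mat n n" "mat_trace \<rho> = 1"
    using \<rho> by (auto simp: density_op_def nonneg_op_def)
  have \<psi>: "\<psi> \<in> carrier_mat ?N ?N"
    by (simp add: \<psi>_def)
  have idx: "\<psi> $$ (p, q) = v p * cnj (v q)" if "p < ?N" "q < ?N" for p q
    using that by (simp add: \<psi>_def v_def)
  have v_pair_index: "v (pair_index dC (i, c)) = w i c" if "c < dC" for i c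
    using that by (simp add: v_def pair_index_div_mod)
  have "mat_trace \<psi> = (\<Sum>p<?N. v p * cnj (v p))"
    unfolding mat_trace_ktrace[OF \<psi>] ktrace_def by (intro sum.cong refl) (simp add: idx)
  also have "\<dots> = (\<Sum>i<n. \<Sum>c<dC. w i c * cnj (w i c))"
    unfolding sum_pair_index by (intro sum.cong refl) (simp add: v_pair_index)
  also have "\<dots> = mat_trace \<rho>"
    unfolding mat_trace_ktrace[OF \<rho>n(1)] ktrace_def
    using w by (intro sum.cong refl) (simp add: gram_rep_def)
  finally have tr: "mat_trace \<psi> = 1"
    using \<rho>n(2) by simp
  have "psd {..<?N} (\<lambda>p q. \<psi> $$ (p, q))"
    using psd_gram[of "{..<?N}" "\<lambda>p _. v p" "{()}"]
    by (subst psd_cong[of _ _ "\<lambda>p q. v p * cnj (v q)"]) (auto simp: idx)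
  then have dens: "density_op ?N \<psi>"
    using \<psi> tr by (simp add: density_op_def nonneg_op_iff_psd)
  have "\<exists>j<?N. \<psi> $$ (j, j) \<noteq> 0"
  proof (rule ccontr)
    assume "\<not> ?thesis"
    then have "mat_trace \<psi> = 0"
      unfolding mat_trace_ktrace[OF \<psi>] ktrace_def by (intro sum.neutral) auto
    then show False
      using tr by simp
  qed
  then have rank: "vec_space.rank ?N \<psi> = 1"
    using rank_outer_product[OF \<psi>, of v] idx by blast
  have "ptrace_last n dC \<psi> = \<rho>"
  proof (rule eq_matI)
    fix i j assume "i < dim_row \<rho>" "j < dim_col \<rho>"
    then have ij: "i < n" "j < n"
      using \<rho>n by auto
    have "ptrace_last n dC \<psi> $$ (i, j) = (\<Sum>c<dC. \<psi> $$ (pair_index dC (i, c), pair_index dC (j, c)))"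
      using ij by (simp add: ptrace_last_def pair_index_def)
    also have "\<dots> = (\<Sum>c<dC. w i c * cnj (w j c))"
      using ij by (intro sum.cong refl) (simp add: idx pair_index_less v_pair_index)
    finally show "ptrace_last n dC \<psi> $$ (i, j) = \<rho> $$ (i, j)"
      using w ij by (simp add: gram_rep_def)
  qed (use \<rho>n in \<open>auto simp: ptrace_last_def\<close>)
  then show ?thesis
    using dens rank by (simp add: is_purification_def)
qed

text \<open>Rank one gives an outer product, and tracing out the last factor turns its amplitudes
  into the Gram condition.\<close>

lemma is_purification_outerE:
  assumes "is_purification n dC \<rho> \<psi>"
  shows "\<exists>w. gram_rep n dC \<rho> w \<and> (\<forall>i<n. \<forall>j<n. \<forall>c<dC. \<forall>d<dC.
    \<psi> $$ (pair_index dC (i, c), pair_index dC (j, d)) = w i c * cnj (w j d))"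
proof -
  from assms have "density_op (n * dC) \<psi>" "vec_space.rank (n * dC) \<psi> = 1" and \<rho>: "ptrace_last n dC \<psi> = \<rho>"
    by (auto simp: is_purification_def)
  then obtain v where v: "\<forall>p<n * dC. \<forall>q<n * dC. \<psi> $$ (p, q) = v p * cnj (v q)"
    using density_rank_one_outer by blast
  define w where "w = (\<lambda>i c. v (pair_index dC (i, c)))"
  have \<psi>: "\<psi> $$ (pair_index dC (i, c), pair_index dC (j, d)) = w i c * cnj (w j d)"
    if "i < n" "j < n" "c < dC" "d < dC" for i j c d
    using v that pair_index_less by (simp add: w_def)
  moreover have "\<rho> $$ (i, j) = (\<Sum>c<dC. w i c * cnj (w j c))" if ij: "i < n" "j < n" for i j
  proof -
    have "\<rho> $$ (i, j) = (\<Sum>c<dC. \<psi> $$ (pair_index dC (i, c), pair_index dC (j, c)))"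
      unfolding \<rho>[symmetric] using ij by (simp add: ptrace_last_def pair_index_def)
    also have "\<dots> = (\<Sum>c<dC. w i c * cnj (w j c))"
      using ij by (intro sum.cong refl) (simp add: \<psi>)
    finally show ?thesis .
  qed
  ultimately show ?thesis
    unfolding gram_rep_def by blast
qed

lemma pair_index_assoc: "pair_index f (pair_index e (i, j), k) = (i * e + j) * f + k"
  by (simp add: pair_index_def)

lemma kernel_ptrace_mid:
  assumes \<psi>: "\<forall>i<dA * dB. \<forall>j<dA * dB. \<forall>c<dC. \<forall>d<dC.
      \<psi> $$ (pair_index dC (i, c), pair_index dC (j, d)) = w i c * cnj (w j d)"
    and pq: "p \<in> {..<dA} \<times> {..<dC}" "q \<in> {..<dA} \<times> {..<dC}"
  shows "kernel dC (ptrace_mid dA dB dC \<psi>) p q = reduced {..<dB} (bipartite dB w) p q"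
proof -
  obtain a c a' c' where [simp]: "p = (a, c)" "q = (a', c')"
    by (cases p; cases q)
  have less: "a < dA" "c < dC" "a' < dA" "c' < dC"
    using pq by auto
  have "kernel dC (ptrace_mid dA dB dC \<psi>) p q
      = (\<Sum>b<dB. \<psi> $$ (pair_index dC (pair_index dB (a, b), c), pair_index dC (pair_index dB (a', b), c')))"
    using less pair_index_less[of a dA c dC] pair_index_less[of a' dA c' dC]
    by (simp add: kernel_def ptrace_mid_def pair_index_div_mod pair_index_assoc)
  also have "\<dots> = (\<Sum>b<dB. w (pair_index dB (a, b)) c * cnj (w (pair_index dB (a', b)) c'))"
    using less by (intro sum.cong refl) (simp add: \<psi> pair_index_less)
  finally show ?thesis
    by (simp add: reduced_def bipartite_def)
qed

lemma ktrace_reduced: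
  "ktrace (A \<times> C) (reduced B w) = (\<Sum>p\<in>A \<times> B. \<Sum>c\<in>C. w p c * cnj (w p c))"
  unfolding ktrace_def reduced_def sum_Times case_prod_conv
  by (rule sum.cong[OF refl], rule sum.swap)

lemma ktrace_reduced_gram_rep:
  assumes \<rho>: "density_op (dA * dB) \<rho>" and w: "gram_rep (dA * dB) dC \<rho> w"
  shows "ktrace ({..<dA} \<times> {..<dC}) (reduced {..<dB} (bipartite dB w)) = 1"
proof -
  have "ktrace ({..<dA} \<times> {..<dC}) (reduced {..<dB} (bipartite dB w))
      = ktrace ({..<dA} \<times> {..<dB}) (kernel dB \<rho>)"
    unfolding ktrace_reduced unfolding ktrace_def kernel_def bipartite_def
    using w by (intro sum.cong refl) (auto simp: gram_rep_def pair_index_less)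
  then show ?thesis
    using \<rho> by (simp add: density_op_iff_kernel)
qed

lemma H_min_ptrace_mid:
  assumes \<rho>: "density_op (dA * dB) \<rho>" and w: "gram_rep (dA * dB) dC \<rho> w"
    and \<psi>: "\<forall>i<dA * dB. \<forall>j<dA * dB. \<forall>c<dC. \<forall>d<dC.
      \<psi> $$ (pair_index dC (i, c), pair_index dC (j, d)) = w i c * cnj (w j d)"
  shows "H_min dA dC (ptrace_mid dA dB dC \<psi>)
    = ereal (- log 2 (cost {..<dA} {..<dC} (reduced {..<dB} (bipartite dB w))))"
proof -
  note ker = kernel_ptrace_mid[OF \<psi>]
  have cost: "cost {..<dA} {..<dC} (kernel dC (ptrace_mid dA dB dC \<psi>))
      = cost {..<dA} {..<dC} (reduced {..<dB} (bipartite dB w))"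
    by (rule cost_cong) (rule ker)
  have "psd ({..<dA} \<times> {..<dC}) (kernel dC (ptrace_mid dA dB dC \<psi>))"
  proof (rule psd_cong[THEN iffD2])
    show "psd ({..<dA} \<times> {..<dC}) (reduced {..<dB} (bipartite dB w))"
      by (rule psd_reduced)
  qed (rule ker)
  moreover have "ktrace ({..<dA} \<times> {..<dC}) (kernel dC (ptrace_mid dA dB dC \<psi>))
      = ktrace ({..<dA} \<times> {..<dC}) (reduced {..<dB} (bipartite dB w))"
    unfolding ktrace_def by (intro sum.cong refl ker)
  moreover have "ptrace_mid dA dB dC \<psi> \<in> carrier_mat (dA * dC) (dA * dC)"
    by (simp add: ptrace_mid_def)
  ultimately have "density_op (dA * dC) (ptrace_mid dA dB dC \<psi>)"
    unfolding density_op_iff_kernel using ktrace_reduced_gram_rep[OF \<rho> w] by simp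
  from H_min_eq_cost[OF this] show ?thesis
    using cost by simp
qed

text \<open>\<open>THE\<close> asks for existence, given by the outer product of \<open>w\<close>,
  and uniqueness: the amplitudes \<open>u\<close> of any other purification have the same Gram
  kernel, so \<open>cost_reduced_le\<close> applies in both directions.\<close>

lemma H_max_eq_cost:
  assumes \<rho>: "density_op (dA * dB) \<rho>" and w: "gram_rep (dA * dB) dC \<rho> w"
  shows "H_max dA dB \<rho> = ereal (log 2 (cost {..<dA} {..<dC} (reduced {..<dB} (bipartite dB w))))"
  unfolding H_max_def
proof (rule the_equality)
  define \<psi> where "\<psi> = mat (dA * dB * dC) (dA * dB * dC)
    (\<lambda>(p, q). w (p div dC) (p mod dC) * cnj (w (q div dC) (q mod dC)))"
  have "\<forall>i<dA * dB. \<forall>j<dA * dB. \<forall>c<dC. \<forall>d<dC.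
      \<psi> $$ (pair_index dC (i, c), pair_index dC (j, d)) = w i c * cnj (w j d)"
    by (simp add: \<psi>_def pair_index_less pair_index_div_mod)
  from H_min_ptrace_mid[OF \<rho> w this] is_purification_outer[OF \<rho> w, folded \<psi>_def]
  show "\<exists>dC' \<psi>. is_purification (dA * dB) dC' \<rho> \<psi>
      \<and> ereal (log 2 (cost {..<dA} {..<dC} (reduced {..<dB} (bipartite dB w))))
        = - H_min dA dC' (ptrace_mid dA dB dC' \<psi>)"
    by (intro exI[of _ dC] exI[of _ \<psi>]) simp
next
  fix h assume "\<exists>dC \<psi>. is_purification (dA * dB) dC \<rho> \<psi> \<and> h = - H_min dA dC (ptrace_mid dA dB dC \<psi>)"
  then obtain dC' \<psi> where pur: "is_purification (dA * dB) dC' \<rho> \<psi>"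
    and h: "h = - H_min dA dC' (ptrace_mid dA dB dC' \<psi>)"
    by blast
  from is_purification_outerE[OF pur] obtain u where u: "gram_rep (dA * dB) dC' \<rho> u"
    and \<psi>: "\<forall>i<dA * dB. \<forall>j<dA * dB. \<forall>c<dC'. \<forall>d<dC'.
      \<psi> $$ (pair_index dC' (i, c), pair_index dC' (j, d)) = u i c * cnj (u j d)"
    by blast
  have gram: "\<forall>p\<in>{..<dA} \<times> {..<dB}. \<forall>q\<in>{..<dA} \<times> {..<dB}.
      (\<Sum>c<dC. bipartite dB w p c * cnj (bipartite dB w q c))
        = (\<Sum>c<dC'. bipartite dB u p c * cnj (bipartite dB u q c))"
    using w u pair_index_less by (auto simp: gram_rep_def bipartite_def)
  have A: "{..<dA} \<noteq> {}"
    using ktrace_reduced_gram_rep[OF \<rho> w] by (auto simp: ktrace_def)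
  have "cost {..<dA} {..<dC} (reduced {..<dB} (bipartite dB w))
      = cost {..<dA} {..<dC'} (reduced {..<dB} (bipartite dB u))"
  proof (rule antisym)
    show "cost {..<dA} {..<dC'} (reduced {..<dB} (bipartite dB u))
        \<le> cost {..<dA} {..<dC} (reduced {..<dB} (bipartite dB w))"
      by (rule cost_reduced_le[OF _ _ _ _ A gram]) simp_all
    have gram': "\<forall>p\<in>{..<dA} \<times> {..<dB}. \<forall>q\<in>{..<dA} \<times> {..<dB}.
      (\<Sum>c<dC'. bipartite dB u p c * cnj (bipartite dB u q c))
        = (\<Sum>c<dC. bipartite dB w p c * cnj (bipartite dB w q c))"
      using gram by simp
    show "cost {..<dA} {..<dC} (reduced {..<dB} (bipartite dB w))
        \<le> cost {..<dA} {..<dC'} (reduced {..<dB} (bipartite dB u))"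
      by (rule cost_reduced_le[OF _ _ _ _ A gram']) simp_all
  qed
  then show "h = ereal (log 2 (cost {..<dA} {..<dC} (reduced {..<dB} (bipartite dB w))))"
    using h H_min_ptrace_mid[OF \<rho> u \<psi>] by simp
qed

subsection \<open>Additivity\<close>

text \<open>In index arithmetic \<open>reorder_index\<close> exchanges the two middle factors, as
  \<open>swap_mid\<close> does on tuples.\<close>

lemma reorder_index_pair_index:
  assumes "a' < dA'" "b < dB" "b' < dB'"
  shows "reorder_index dA' dB dB' (pair_index (dB * dB') (pair_index dA' (a, a'), pair_index dB' (b, b')))
    = pair_index (dA' * dB') (pair_index dB (a, b), pair_index dB' (a', b'))"
  using assms pair_index_less[of b dB b' dB']
  by (simp add: reorder_index_def Let_def pair_index_div_mod) (simp add: pair_index_def)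

section \<open>The reordered tensor product of two fixed density operators\<close>

context
  fixes dA dA' dB dB' :: nat and \<rho> \<rho>' :: "complex mat"
  assumes \<rho>: "density_op (dA * dB) \<rho>" and \<rho>': "density_op (dA' * dB') \<rho>'"
begin

lemma reorder_tensor_index:
  assumes "p \<in> ({..<dA} \<times> {..<dA'}) \<times> ({..<dB} \<times> {..<dB'})"
    and "q \<in> ({..<dA} \<times> {..<dA'}) \<times> ({..<dB} \<times> {..<dB'})"
  shows "kernel (dB * dB') (reorder_mat dA dA' dB dB' (tensor_mat \<rho> \<rho>')) (map_prod (pair_index dA') (pair_index dB') p) (map_prod (pair_index dA') (pair_index dB') q)
    = tensor_kernel (kernel dB \<rho>) (kernel dB' \<rho>') p q"
proof -
  let ?\<tau> = "reorder_mat dA dA' dB dB' (tensor_mat \<rho> \<rho>')"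
  obtain a a' b b' where p: "p = ((a, a'), (b, b'))"
    by (metis prod.exhaust)
  obtain c c' d d' where q: "q = ((c, c'), (d, d'))"
    by (metis prod.exhaust)
  have less: "a < dA" "a' < dA'" "b < dB" "b' < dB'" "c < dA" "c' < dA'" "d < dB" "d' < dB'"
    using assms by (auto simp: p q)
  have car: "\<rho> \<in> carrier_mat (dA * dB) (dA * dB)" "\<rho>' \<in> carrier_mat (dA' * dB') (dA' * dB')"
    using \<rho> \<rho>' by (auto simp: density_op_iff_kernel)
  have "kernel (dB * dB') ?\<tau> (map_prod (pair_index dA') (pair_index dB') p) (map_prod (pair_index dA') (pair_index dB') q)
      = tensor_mat \<rho> \<rho>' $$ (pair_index (dA' * dB') (pair_index dB (a, b), pair_index dB' (a', b')),
          pair_index (dA' * dB') (pair_index dB (c, d), pair_index dB' (c', d')))"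
    using less by (simp add: kernel_def p q reorder_mat_def reorder_index_pair_index pair_index_less)
  also have "\<dots> = \<rho> $$ (pair_index dB (a, b), pair_index dB (c, d)) * \<rho>' $$ (pair_index dB' (a', b'), pair_index dB' (c', d'))"
    using less by (intro tensor_mat_index[OF car] pair_index_less)
  finally show ?thesis
    by (simp add: p q tensor_kernel_def swap_mid_def kernel_def)
qed

lemma bij_betw_pair_index_prod:
  "bij_betw (map_prod (pair_index dA') (pair_index dB')) (({..<dA} \<times> {..<dA'}) \<times> ({..<dB} \<times> {..<dB'}))
    ({..<dA * dA'} \<times> {..<dB * dB'})"
  by (intro bij_betw_map_prod bij_betw_pair_index)

lemma density_op_reorder_tensor:
  "density_op ((dA * dA') * (dB * dB')) (reorder_mat dA dA' dB dB' (tensor_mat \<rho> \<rho>'))"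
proof -
  let ?\<tau> = "reorder_mat dA dA' dB dB' (tensor_mat \<rho> \<rho>')"
  let ?P = "({..<dA} \<times> {..<dA'}) \<times> ({..<dB} \<times> {..<dB'})" and ?g = "map_prod (pair_index dA') (pair_index dB')"
  have k: "psd ({..<dA} \<times> {..<dB}) (kernel dB \<rho>)" "ktrace ({..<dA} \<times> {..<dB}) (kernel dB \<rho>) = 1"
    "psd ({..<dA'} \<times> {..<dB'}) (kernel dB' \<rho>')" "ktrace ({..<dA'} \<times> {..<dB'}) (kernel dB' \<rho>') = 1"
    using \<rho> \<rho>' by (auto simp: density_op_iff_kernel)
  have "psd ?P (tensor_kernel (kernel dB \<rho>) (kernel dB' \<rho>'))"
    using k by (intro psd_tensor_kernel) auto
  then have "psd ?P (\<lambda>p q. kernel (dB * dB') ?\<tau> (?g p) (?g q))"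
    by (rule psd_cong[THEN iffD1, rotated]) (rule reorder_tensor_index[symmetric])
  then have "psd ({..<dA * dA'} \<times> {..<dB * dB'}) (kernel (dB * dB') ?\<tau>)"
    by (rule psd_reindex[OF bij_betw_pair_index_prod, THEN iffD1])
  moreover have "ktrace ({..<dA * dA'} \<times> {..<dB * dB'}) (kernel (dB * dB') ?\<tau>)
      = ktrace ?P (\<lambda>p q. kernel (dB * dB') ?\<tau> (?g p) (?g q))"
    by (rule ktrace_reindex[OF bij_betw_pair_index_prod, symmetric])
  moreover have "\<dots> = ktrace ?P (tensor_kernel (kernel dB \<rho>) (kernel dB' \<rho>'))"
    unfolding ktrace_def by (intro sum.cong refl reorder_tensor_index)
  moreover have "\<dots> = 1"
    unfolding tensor_kernel_def ktrace_reindex[OF bij_betw_swap_mid] ktrace_tensor by (simp add: k)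
  ultimately show ?thesis
    unfolding density_op_iff_kernel by (simp add: reorder_mat_def)
qed

lemma lessThan_dims_nonempty: "{..<dA} \<noteq> {}" "{..<dA'} \<noteq> {}"
  using \<rho> \<rho>' by (auto simp: density_op_iff_kernel ktrace_def)

lemma H_min_additive:
  "H_min (dA * dA') (dB * dB') (reorder_mat dA dA' dB dB' (tensor_mat \<rho> \<rho>')) = H_min dA dB \<rho> + H_min dA' dB' \<rho>'"
proof -
  let ?\<tau> = "reorder_mat dA dA' dB dB' (tensor_mat \<rho> \<rho>')"
  have psd: "psd ({..<dA} \<times> {..<dB}) (kernel dB \<rho>)" "psd ({..<dA'} \<times> {..<dB'}) (kernel dB' \<rho>')"
    and tr: "ktrace ({..<dA} \<times> {..<dB}) (kernel dB \<rho>) = 1" "ktrace ({..<dA'} \<times> {..<dB'}) (kernel dB' \<rho>') = 1"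
    using \<rho> \<rho>' by (auto simp: density_op_iff_kernel)
  have "cost {..<dA * dA'} {..<dB * dB'} (kernel (dB * dB') ?\<tau>)
      = cost ({..<dA} \<times> {..<dA'}) ({..<dB} \<times> {..<dB'})
          (\<lambda>(a, b) (c, d). kernel (dB * dB') ?\<tau> (pair_index dA' a, pair_index dB' b) (pair_index dA' c, pair_index dB' d))"
    by (rule cost_reindex[OF bij_betw_pair_index bij_betw_pair_index, symmetric])
  also have "\<dots> = cost ({..<dA} \<times> {..<dA'}) ({..<dB} \<times> {..<dB'}) (tensor_kernel (kernel dB \<rho>) (kernel dB' \<rho>'))"
    using reorder_tensor_index by (intro cost_cong) (simp add: case_prod_unfold map_prod_def)
  also have "\<dots> = cost {..<dA} {..<dB} (kernel dB \<rho>) * cost {..<dA'} {..<dB'} (kernel dB' \<rho>')"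
    by (rule cost_tensor_kernel) (use psd lessThan_dims_nonempty in simp_all)
  finally show ?thesis
    using cost_pos[OF _ _ psd(1) tr(1)] cost_pos[OF _ _ psd(2) tr(2)]
    by (simp add: H_min_eq_cost[OF \<rho>] H_min_eq_cost[OF \<rho>'] H_min_eq_cost[OF density_op_reorder_tensor] log_mult)
qed

text \<open>Amplitudes multiply to amplitudes of the joint state with purifying system
  \<open>C \<times> C'\<close>. Its reduced state is the tensor product of the reduced ones, so
  \<open>cost_tensor_kernel\<close> applies with \<open>C\<close> in the role of
  \<open>B\<close>.\<close>

lemma H_max_additive:
  "H_max (dA * dA') (dB * dB') (reorder_mat dA dA' dB dB' (tensor_mat \<rho> \<rho>')) = H_max dA dB \<rho> + H_max dA' dB' \<rho>'"
proof -
  let ?\<tau> = "reorder_mat dA dA' dB dB' (tensor_mat \<rho> \<rho>')"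
  obtain dC w where w: "gram_rep (dA * dB) dC \<rho> w"
    using gram_rep_exists[OF \<rho>] by blast
  obtain dC' w' where w': "gram_rep (dA' * dB') dC' \<rho>' w'"
    using gram_rep_exists[OF \<rho>'] by blast
  define r where "r = reorder_index dA' dB dB'"
  \<comment> \<open>\<open>r\<close> moves an index from the order \<open>A A' B B'\<close> to
    \<open>A B A' B'\<close>, where it splits into the arguments of \<open>w\<close> and
    \<open>w'\<close>.\<close>
  define W where "W = (\<lambda>i c. w (r i div (dA' * dB')) (c div dC') * w' (r i mod (dA' * dB')) (c mod dC'))"
  have W_pair_index: "W (pair_index (dB * dB') (pair_index dA' (a, a'), pair_index dB' (b, b'))) (pair_index dC' (c, c'))
      = w (pair_index dB (a, b)) c * w' (pair_index dB' (a', b')) c'"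
    if "a' < dA'" "b < dB" "b' < dB'" "c' < dC'" for a a' b b' c c'
    using that by (simp add: W_def r_def reorder_index_pair_index pair_index_div_mod pair_index_less)
  have W: "gram_rep ((dA * dA') * (dB * dB')) (dC * dC') ?\<tau> W"
    unfolding gram_rep_def
  proof (intro allI impI)
    fix i j assume ij: "i < (dA * dA') * (dB * dB')" "j < (dA * dA') * (dB * dB')"
    have dec: "\<exists>p\<in>({..<dA} \<times> {..<dA'}) \<times> ({..<dB} \<times> {..<dB'}).
        i = pair_index (dB * dB') (map_prod (pair_index dA') (pair_index dB') p)" if "i < (dA * dA') * (dB * dB')" for i
    proof -
      have "bij_betw (pair_index (dB * dB') \<circ> map_prod (pair_index dA') (pair_index dB'))
          (({..<dA} \<times> {..<dA'}) \<times> ({..<dB} \<times> {..<dB'})) {..<(dA * dA') * (dB * dB')}"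
        by (rule bij_betw_trans[OF bij_betw_pair_index_prod bij_betw_pair_index])
      then show ?thesis
        using that unfolding bij_betw_def by (auto simp: image_iff set_eq_iff)
    qed
    from dec[OF ij(1)] obtain p where
      p: "p \<in> ({..<dA} \<times> {..<dA'}) \<times> ({..<dB} \<times> {..<dB'})" "i = pair_index (dB * dB') (map_prod (pair_index dA') (pair_index dB') p)"
      by blast
    from dec[OF ij(2)] obtain q where
      q: "q \<in> ({..<dA} \<times> {..<dA'}) \<times> ({..<dB} \<times> {..<dB'})" "j = pair_index (dB * dB') (map_prod (pair_index dA') (pair_index dB') q)"
      by blast
    obtain a a' b b' where pe: "p = ((a, a'), (b, b'))"
      by (metis prod.exhaust)
    obtain x x' y y' where qe: "q = ((x, x'), (y, y'))"
      by (metis prod.exhaust)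
    have less: "a < dA" "a' < dA'" "b < dB" "b' < dB'" "x < dA" "x' < dA'" "y < dB" "y' < dB'"
      using p(1) q(1) by (auto simp: pe qe)
    have "(\<Sum>c<dC * dC'. W i c * cnj (W j c))
        = (\<Sum>c<dC. \<Sum>c'<dC'. (w (pair_index dB (a, b)) c * cnj (w (pair_index dB (x, y)) c))
            * (w' (pair_index dB' (a', b')) c' * cnj (w' (pair_index dB' (x', y')) c')))"
      unfolding sum_pair_index p(2) q(2) pe qe map_prod_simp
      using less by (intro sum.cong refl) (simp add: W_pair_index mult_ac)
    also have "\<dots> = \<rho> $$ (pair_index dB (a, b), pair_index dB (x, y)) * \<rho>' $$ (pair_index dB' (a', b'), pair_index dB' (x', y'))"
      using w w' less by (simp add: gram_rep_def pair_index_less sum_product)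
    also have "\<dots> = ?\<tau> $$ (i, j)"
      using reorder_tensor_index[OF p(1) q(1)] by (simp add: kernel_def tensor_kernel_def swap_mid_def p(2) q(2) pe qe)
    finally show "?\<tau> $$ (i, j) = (\<Sum>c<dC * dC'. W i c * cnj (W j c))" ..
  qed
  let ?R = "reduced {..<dB} (bipartite dB w)" and ?R' = "reduced {..<dB'} (bipartite dB' w')"
    and ?RR = "reduced {..<dB * dB'} (bipartite (dB * dB') W)"
  have "cost {..<dA * dA'} {..<dC * dC'} ?RR
      = cost ({..<dA} \<times> {..<dA'}) ({..<dC} \<times> {..<dC'})
          (\<lambda>(a, c) (a', c'). ?RR (pair_index dA' a, pair_index dC' c) (pair_index dA' a', pair_index dC' c'))"
    by (rule cost_reindex[OF bij_betw_pair_index bij_betw_pair_index, symmetric])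
  also have "\<dots> = cost ({..<dA} \<times> {..<dA'}) ({..<dC} \<times> {..<dC'}) (tensor_kernel ?R ?R')"
  proof (rule cost_cong)
    fix p q assume "p \<in> ({..<dA} \<times> {..<dA'}) \<times> ({..<dC} \<times> {..<dC'})"
      and "q \<in> ({..<dA} \<times> {..<dA'}) \<times> ({..<dC} \<times> {..<dC'})"
    then obtain a a' c c' x x' z z' where pq: "p = ((a, a'), (c, c'))" "q = ((x, x'), (z, z'))"
      and less: "a' < dA'" "c' < dC'" "x' < dA'" "z' < dC'"
      by auto
    \<comment> \<open>The sum over the traced-out pair \<open>b\<close>, \<open>b'\<close> separates
      into one sum for each reduced state.\<close>
    have "?RR (pair_index dA' (a, a'), pair_index dC' (c, c')) (pair_index dA' (x, x'), pair_index dC' (z, z'))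
        = (\<Sum>b<dB. \<Sum>b'<dB'. (w (pair_index dB (a, b)) c * cnj (w (pair_index dB (x, b)) z))
            * (w' (pair_index dB' (a', b')) c' * cnj (w' (pair_index dB' (x', b')) z')))"
      unfolding reduced_def bipartite_def case_prod_conv sum_pair_index
      using less by (intro sum.cong refl) (simp add: W_pair_index mult_ac)
    then show "(\<lambda>(a, c) (a', c'). ?RR (pair_index dA' a, pair_index dC' c) (pair_index dA' a', pair_index dC' c')) p q = tensor_kernel ?R ?R' p q"
      by (simp add: pq tensor_kernel_def swap_mid_def reduced_def bipartite_def sum_product)
  qed
  also have "\<dots> = cost {..<dA} {..<dC} ?R * cost {..<dA'} {..<dC'} ?R'"
    by (rule cost_tensor_kernel) (use psd_reduced lessThan_dims_nonempty in simp_all)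
  finally show ?thesis
    using cost_pos[OF _ _ psd_reduced ktrace_reduced_gram_rep[OF \<rho> w]]
      cost_pos[OF _ _ psd_reduced ktrace_reduced_gram_rep[OF \<rho>' w']]
    by (simp add: H_max_eq_cost[OF \<rho> w] H_max_eq_cost[OF \<rho>' w']
        H_max_eq_cost[OF density_op_reorder_tensor W] log_mult)
qed

end

theorem mainTheorem4:
  fixes dA dA' dB dB' :: nat and \<rho> \<rho>' :: "complex mat"
  assumes "density_op (dA * dB) \<rho>" and "density_op (dA' * dB') \<rho>'"
  shows "H_min (dA * dA') (dB * dB') (reorder_mat dA dA' dB dB' (tensor_mat \<rho> \<rho>'))
           = H_min dA dB \<rho> + H_min dA' dB' \<rho>'
       \<and> H_max (dA * dA') (dB * dB') (reorder_mat dA dA' dB dB' (tensor_mat \<rho> \<rho>'))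
           = H_max dA dB \<rho> + H_max dA' dB' \<rho>'"
  using H_min_additive[OF assms] H_max_additive[OF assms] by blast

end
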